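(* Let $1\le p<\infty$, let $\mu$ be a positive Borel measure on $\mathbb{D}$ satisfying the standing axiom on $D^p_\mu$ stated in the context, and let $\varphi$ be an analytic self-map of $\mathbb{D}$. Suppose that $C_\varphi$ is a bounded operator from $\mathcal{B}$ to $M(D^p_\mu)$. Then the following statements are equivalent: (a) $C_\varphi$ is a compact operator from $\mathcal{B}$ to $M(D^p_\mu)$. (b) $C_\varphi$ is a weakly compact operator from $\mathcal{B}$ to $M(D^p_\mu)$. (c) $\displaystyle\lim_{r\to 1}\ \sup_{\sigma\in Aut(\mathbb{D})}\int_{\{z\in\mathbb{D}:\,|(\varphi\circ\sigma)(z)|>r\}} |(\varphi\circ\sigma)^{\#}|^p\,d\mu=0$.
   Context: $\mathbb{D}=\{z\in\mathbb{C}:|z|<1\}$; $\mathcal{H}(\mathbb{D})$ is the set of analytic functions on $\mathbb{D}$; $Aut(\mathbb{D})$ is the group of disk automorphisms, i.e. one-to-one analytic maps of $\mathbb{D}$ onto itself. A self-map of $\mathbb{D}$ is an analytic function $\varphi:\mathbb{D}\to\mathbb{D}$, and $C_\varphi(f)=f\circ\varphi$ for $f\in\mathcal{H}(\mathbb{D})$. For a self-map $\varphi$, the hyperbolic derivative is $\varphi^{\#}(z)=\frac{|\varphi'(z)|}{1-|\varphi(z)|^2}$. The Bloch space $\mathcal{B}$ is the Banach space of all $f\in\mathcal{H}(\mathbb{D})$ with $\|f\|_{\mathcal{B}}=|f(0)|+\sup_{z\in\mathbb{D}}(1-|z|^2)|f'(z)|<\infty$. For a positive Borel measure $\mu$ on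 $\mathbb{D}$ and $1\le p<\infty$, $D^p_\mu$ is the space of all $f\in\mathcal{H}(\mathbb{D})$ with $\|f\|_{D^p_\mu}^p=|f(0)|^p+\int_{\mathbb{D}}|f'|^p\,d\mu<\infty$. Standing axiom: $D^p_\mu$ is a Banach space and the point-evaluation functionals $f\mapsto f(\zeta)$ are uniformly bounded on $D^p_\mu$ for $\zeta$ in compact subsets of $\mathbb{D}$ (for each compact $K\subset\mathbb{D}$ there is $C_K$ with $|f(\zeta)|\le C_K\|f\|_{D^p_\mu}$ for all $\zeta\in K$, $f\in D^p_\mu$). The measure $\mu$ need not be finite. $M(D^p_\mu)$ is the space of all $f\in\mathcal{H}(\mathbb{D})$ with $\|f\|_{M(D^p_\mu)}^p=|f(0)|^p+\sup_{\sigma\in Aut(\mathbb{D})}\int_{\mathbb{D}}|(f\circ\sigma)'|^p\,d\mu<\infty$. *)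

theory Defs
  imports "HOL-Analysis.Analysis"
begin

section \<open>Normed spaces of functions given by a carrier and a norm\<close>

text \<open>
  The spaces below depend on a measure and an exponent, so they are sets of functions together
  with a real-valued norm, both used on the carrier only. Linear structure is pointwise and
  the scalars are complex.
\<close>

definition normed_fun_space :: "('a \<Rightarrow> complex) set \<Rightarrow> (('a \<Rightarrow> complex) \<Rightarrow> real) \<Rightarrow> bool" where
  "normed_fun_space X N \<longleftrightarrow>
     (\<lambda>x. 0) \<in> X \<and>
     (\<forall>f\<in>X. \<forall>g\<in>X. (\<lambda>x. f x + g x) \<in> X) \<and>
     (\<forall>c. \<forall>f\<in>X. (\<lambda>x. c * f x) \<in> X) \<and>
     (\<forall>f\<in>X. 0 \<le> N f) \<and>
     (\<forall>f\<in>X. N f = 0 \<longleftrightarrow> f = (\<lambda>x. 0)) \<and>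
     (\<forall>c. \<forall>f\<in>X. N (\<lambda>x. c * f x) = cmod c * N f) \<and>
     (\<forall>f\<in>X. \<forall>g\<in>X. N (\<lambda>x. f x + g x) \<le> N f + N g)"

definition fun_dist ::
    "(('a \<Rightarrow> complex) \<Rightarrow> real) \<Rightarrow> ('a \<Rightarrow> complex) \<Rightarrow> ('a \<Rightarrow> complex) \<Rightarrow> real" where
  "fun_dist N f g = N (\<lambda>x. f x - g x)"

definition banach_fun_space :: "('a \<Rightarrow> complex) set \<Rightarrow> (('a \<Rightarrow> complex) \<Rightarrow> real) \<Rightarrow> bool" where
  "banach_fun_space X N \<longleftrightarrow> normed_fun_space X N \<and> Metric_space.mcomplete X (fun_dist N)"

definition norm_topology ::
    "('a \<Rightarrow> complex) set \<Rightarrow> (('a \<Rightarrow> complex) \<Rightarrow> real) \<Rightarrow> ('a \<Rightarrow> complex) topology" where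
  "norm_topology X N = Metric_space.mtopology X (fun_dist N)"

text \<open>Functionals are total functions, of which only the values on the carrier matter.\<close>

definition fun_dual ::
    "('a \<Rightarrow> complex) set \<Rightarrow> (('a \<Rightarrow> complex) \<Rightarrow> real) \<Rightarrow> (('a \<Rightarrow> complex) \<Rightarrow> complex) set" where
  "fun_dual X N =
     {l. (\<forall>f\<in>X. \<forall>g\<in>X. l (\<lambda>x. f x + g x) = l f + l g) \<and>
         (\<forall>c. \<forall>f\<in>X. l (\<lambda>x. c * f x) = c * l f) \<and>
         (\<exists>C. \<forall>f\<in>X. cmod (l f) \<le> C * N f)}"

definition weak_topology ::
    "('a \<Rightarrow> complex) set \<Rightarrow> (('a \<Rightarrow> complex) \<Rightarrow> real) \<Rightarrow> ('a \<Rightarrow> complex) topology" where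
  "weak_topology X N =
     topology_generated_by {{f\<in>X. l f \<in> U} | l U. l \<in> fun_dual X N \<and> open U}"

definition bounded_operator ::
    "('a \<Rightarrow> complex) set \<Rightarrow> (('a \<Rightarrow> complex) \<Rightarrow> real) \<Rightarrow>
     ('b \<Rightarrow> complex) set \<Rightarrow> (('b \<Rightarrow> complex) \<Rightarrow> real) \<Rightarrow>
     (('a \<Rightarrow> complex) \<Rightarrow> ('b \<Rightarrow> complex)) \<Rightarrow> bool" where
  "bounded_operator X N Y M T \<longleftrightarrow>
     (\<forall>f\<in>X. T f \<in> Y) \<and>
     (\<forall>f\<in>X. \<forall>g\<in>X. T (\<lambda>x. f x + g x) = (\<lambda>y. T f y + T g y)) \<and>
     (\<forall>c. \<forall>f\<in>X. T (\<lambda>x. c * f x) = (\<lambda>y. c * T f y)) \<and>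
     (\<exists>C. \<forall>f\<in>X. M (T f) \<le> C * N f)"

definition compact_operator ::
    "('a \<Rightarrow> complex) set \<Rightarrow> (('a \<Rightarrow> complex) \<Rightarrow> real) \<Rightarrow>
     ('b \<Rightarrow> complex) set \<Rightarrow> (('b \<Rightarrow> complex) \<Rightarrow> real) \<Rightarrow>
     (('a \<Rightarrow> complex) \<Rightarrow> ('b \<Rightarrow> complex)) \<Rightarrow> bool" where
  "compact_operator X N Y M T \<longleftrightarrow>
     bounded_operator X N Y M T \<and>
     compactin (norm_topology Y M) (norm_topology Y M closure_of (T ` {f\<in>X. N f \<le> 1}))"

definition weakly_compact_operator ::
    "('a \<Rightarrow> complex) set \<Rightarrow> (('a \<Rightarrow> complex) \<Rightarrow> real) \<Rightarrow>
     ('b \<Rightarrow> complex) set \<Rightarrow> (('b \<Rightarrow> complex) \<Rightarrow> real) \<Rightarrow>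
     (('a \<Rightarrow> complex) \<Rightarrow> ('b \<Rightarrow> complex)) \<Rightarrow> bool" where
  "weakly_compact_operator X N Y M T \<longleftrightarrow>
     bounded_operator X N Y M T \<and>
     compactin (weak_topology Y M) (weak_topology Y M closure_of (T ` {f\<in>X. N f \<le> 1}))"

section \<open>Analytic functions on the unit disk\<close>

abbreviation unit_disk :: "complex set" where
  "unit_disk \<equiv> ball 0 1"

text \<open>
  An analytic function on the disk is represented by its extension by \<open>0\<close> to the whole plane, so
  that equality of analytic functions is equality in HOL.
\<close>

definition disk_analytic :: "(complex \<Rightarrow> complex) set" where
  "disk_analytic = {f. f holomorphic_on unit_disk \<and> (\<forall>z. z \<notin> unit_disk \<longrightarrow> f z = 0)}"

definition disk_aut :: "(complex \<Rightarrow> complex) set" where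
  "disk_aut = {\<sigma>. \<sigma> holomorphic_on unit_disk \<and> bij_betw \<sigma> unit_disk unit_disk}"

definition disk_self_map :: "(complex \<Rightarrow> complex) \<Rightarrow> bool" where
  "disk_self_map \<phi> \<longleftrightarrow> \<phi> holomorphic_on unit_disk \<and> \<phi> ` unit_disk \<subseteq> unit_disk"

definition comp_op :: "(complex \<Rightarrow> complex) \<Rightarrow> (complex \<Rightarrow> complex) \<Rightarrow> complex \<Rightarrow> complex" where
  "comp_op \<phi> f = (\<lambda>z. if z \<in> unit_disk then f (\<phi> z) else 0)"

definition hyp_deriv :: "(complex \<Rightarrow> complex) \<Rightarrow> complex \<Rightarrow> real" where
  "hyp_deriv \<phi> z = cmod (deriv \<phi> z) / (1 - (cmod (\<phi> z))\<^sup>2)"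

section \<open>The Bloch space\<close>

definition bloch_space :: "(complex \<Rightarrow> complex) set" where
  "bloch_space =
     {f \<in> disk_analytic. bdd_above ((\<lambda>z. (1 - (cmod z)\<^sup>2) * cmod (deriv f z)) ` unit_disk)}"

definition bloch_norm :: "(complex \<Rightarrow> complex) \<Rightarrow> real" where
  "bloch_norm f = cmod (f 0) + (SUP z\<in>unit_disk. (1 - (cmod z)\<^sup>2) * cmod (deriv f z))"

section \<open>The spaces \<open>D\<^sup>p\<^sub>\<mu>\<close> and \<open>M(D\<^sup>p\<^sub>\<mu>)\<close>\<close>

definition deriv_integral :: "complex measure \<Rightarrow> real \<Rightarrow> (complex \<Rightarrow> complex) \<Rightarrow> ennreal" where
  "deriv_integral \<mu> p f = (\<integral>\<^sup>+ z. ennreal (cmod (deriv f z) powr p) \<partial>\<mu>)"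

definition Dp_space :: "complex measure \<Rightarrow> real \<Rightarrow> (complex \<Rightarrow> complex) set" where
  "Dp_space \<mu> p = {f \<in> disk_analytic. deriv_integral \<mu> p f < \<infinity>}"

definition Dp_norm :: "complex measure \<Rightarrow> real \<Rightarrow> (complex \<Rightarrow> complex) \<Rightarrow> real" where
  "Dp_norm \<mu> p f = (cmod (f 0) powr p + enn2real (deriv_integral \<mu> p f)) powr (1 / p)"

definition aut_deriv_integral :: "complex measure \<Rightarrow> real \<Rightarrow> (complex \<Rightarrow> complex) \<Rightarrow> ennreal" where
  "aut_deriv_integral \<mu> p f = (SUP \<sigma>\<in>disk_aut. deriv_integral \<mu> p (f \<circ> \<sigma>))"

definition MDp_space :: "complex measure \<Rightarrow> real \<Rightarrow> (complex \<Rightarrow> complex) set" where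
  "MDp_space \<mu> p = {f \<in> disk_analytic. aut_deriv_integral \<mu> p f < \<infinity>}"

definition MDp_norm :: "complex measure \<Rightarrow> real \<Rightarrow> (complex \<Rightarrow> complex) \<Rightarrow> real" where
  "MDp_norm \<mu> p f = (cmod (f 0) powr p + enn2real (aut_deriv_integral \<mu> p f)) powr (1 / p)"

definition disk_borel_measure :: "complex measure \<Rightarrow> bool" where
  "disk_borel_measure \<mu> \<longleftrightarrow> sets \<mu> = sets (restrict_space borel unit_disk)"

definition Dp_axiom :: "complex measure \<Rightarrow> real \<Rightarrow> bool" where
  "Dp_axiom \<mu> p \<longleftrightarrow>
     banach_fun_space (Dp_space \<mu> p) (Dp_norm \<mu> p) \<and>
     (\<forall>K. compact K \<and> K \<subseteq> unit_disk \<longrightarrow>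
        (\<exists>C. \<forall>\<zeta>\<in>K. \<forall>f\<in>Dp_space \<mu> p. cmod (f \<zeta>) \<le> C * Dp_norm \<mu> p f))"

end

theory Submission
  imports Defs "HOL-Complex_Analysis.Complex_Analysis"
begin

text \<open>
  Compactness implies weak compactness because the weak topology of \<open>M(D\<^sup>p\<^sub>\<mu>)\<close> is Hausdorff (point
  evaluations are functionals) and coarser than the norm topology.

  (c) implies (a) by Montel's theorem: if functions \<open>h\<close> with bounded Bloch norm tend to \<open>0\<close> locally
  uniformly, split the integral of \<open>\<bar>(h \<circ> \<phi> \<circ> \<sigma>)'\<bar>\<^sup>p\<close> at \<open>\<bar>\<phi> \<circ> \<sigma>\<bar> = r\<close>. The outer part is controlled by
  (c), the inner part by the norm of \<open>\<phi>\<close>, which is the image of the identity.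

  (b) implies (c) by testing on lacunary series \<open>\<Sum>k. c k * z ^ 2 ^ k\<close>, whose Bloch norm is at most
  \<open>6 * sup \<bar>c\<bar>\<close>. Composing with this embedding of \<open>\<ell>\<^sup>\<infinity>\<close> gives a weakly compact operator on \<open>\<ell>\<^sup>\<infinity>\<close>. Such an
  operator is small on sequences supported far out, and averaging over the signs of \<open>c\<close> turns this
  into smallness of the integrals of \<open>sup\<^sub>k \<bar>2 ^ k * w ^ (2 ^ k - 1) * w'\<bar>\<^sup>p\<close> with \<open>w = \<phi> \<circ> \<sigma>\<close>. Near
  the boundary this supremum is comparable to the hyperbolic derivative of \<open>w\<close>.
\<close>

section \<open>Weak topologies and operators on \<open>\<ell>\<^sup>\<infinity>\<close>\<close>

text \<open>The obstacle is that (b) speaks of a single operator, while (c) asks for smallness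
  uniform over the integrals belonging to all automorphisms. Norming functionals bridge this gap:
  each automorphism sigma and each function y give a functional on the target space whose value at y
  is the integral of |(y o sigma)'|^p. A failure of (c) thus becomes a sequence of functionals, each
  of them large on the image of its own block of coefficients. Lacunary series fit because at a
  point w near the boundary one term alone has a derivative of the size 1 / (1 - |w|^2), the largest
  that a Bloch bound allows. Which term this is depends on the point, so a maximum over the terms
  must be integrated, and the sign averages bound it by integrals of derivatives of actual images of
  Bloch functions. In the converse direction mu may be infinite, so uniformly small derivatives do
  not give small integrals; hence the comparison with the integral of |(phi o sigma)'|^p.\<close>

lemma rosenthal_infinite_subset:
  fixes a :: "nat \<Rightarrow> nat \<Rightarrow> real"
  assumes bdd: "\<And>i F. finite F \<Longrightarrow> (\<Sum>j\<in>F. a i j) \<le> C" and "0 < \<epsilon>"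
  obtains M where "infinite M"
    "\<And>i F. i \<in> M \<Longrightarrow> finite F \<Longrightarrow> F \<subseteq> M - {i} \<Longrightarrow> (\<Sum>j\<in>F. a i j) \<le> \<epsilon>"
proof -
  \<comment> \<open>The bound is lowered by epsilon at a time, starting from a multiple of epsilon
    above \<open>C\<close>. The infinite set is cut into infinitely many infinite pieces. If no
    piece is good, each contains a row whose sum over finitely many other indices of the same piece
    exceeds epsilon; keeping just one such row from each piece takes that mass away from every
    row.\<close>
  define good where "good = (\<lambda>c M. \<forall>i\<in>M. \<forall>F. finite F \<longrightarrow> F \<subseteq> M - {i} \<longrightarrow> (\<Sum>j\<in>F. a i j) \<le> c)"
  have step: "\<exists>M. infinite M \<and> good \<epsilon> M" if "infinite S" "good (real n * \<epsilon>) S" for n S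
    using that
  proof (induction n arbitrary: S)
    case 0
    then have "good \<epsilon> S"
      using \<open>0 < \<epsilon>\<close> by (simp add: good_def) (meson less_imp_le order_trans)
    with 0 show ?case by blast
  next
    case (Suc n)
    define P where "P k = range (\<lambda>m. enumerate S (prod_encode (k, m)))" for k
    have inj: "inj (enumerate S)"
      using bij_enumerate[OF Suc.prems(1)] by (simp add: bij_betw_def)
    have PS: "P k \<subseteq> S" for k
      using Suc.prems(1) by (auto simp: P_def enumerate_in_set)
    have inf_P: "infinite (P k)" for k
      unfolding P_def by (rule range_inj_infinite) (auto simp: inj_def inj_eq[OF inj])
    have disj: "k = k'" if "x \<in> P k" "x \<in> P k'" for k k' x
      using that by (auto simp: P_def inj_eq[OF inj])
    show ?case
    proof (cases "\<exists>k. good \<epsilon> (P k)")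
      case True
      then show ?thesis using inf_P by blast
    next
      case False
      then have "\<forall>k. \<exists>i F. i \<in> P k \<and> finite F \<and> F \<subseteq> P k - {i} \<and> \<epsilon> < (\<Sum>j\<in>F. a i j)"
        unfolding good_def not_le by (metis not_le)
      from choice[OF this] obtain i where
        "\<forall>k. \<exists>F. i k \<in> P k \<and> finite F \<and> F \<subseteq> P k - {i k} \<and> \<epsilon> < (\<Sum>j\<in>F. a (i k) j)" by blast
      from choice[OF this] obtain F where iF: "\<And>k. i k \<in> P k" "\<And>k. finite (F k)"
          "\<And>k. F k \<subseteq> P k - {i k}" "\<And>k. \<epsilon> < (\<Sum>j\<in>F k. a (i k) j)"
        by blast
      have "inj i"
        using iF(1) disj by (metis injI)
      have "good (real n * \<epsilon>) (range i)"
        unfolding good_def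
      proof (intro ballI allI impI)
        fix x G assume "x \<in> range i" and G: "finite G" "G \<subseteq> range i - {x}"
        then obtain k where x: "x = i k" by blast
        \<comment> \<open>\<open>i k\<close> is the only chosen row in \<open>P k\<close>, so the
          mass of more than epsilon on \<open>F k\<close> comes on top of that on
          \<open>G\<close>.\<close>
        have "G \<inter> P k = {}"
          using G(2) x iF(1) disj by blast
        then have "(\<Sum>j\<in>G \<union> F k. a x j) = (\<Sum>j\<in>G. a x j) + (\<Sum>j\<in>F k. a x j)"
          using iF(2,3)[of k] G(1) by (intro sum.union_disjoint) auto
        moreover have "(\<Sum>j\<in>G \<union> F k. a x j) \<le> real (Suc n) * \<epsilon>"
        proof -
          have "G \<union> F k \<subseteq> S - {x}"
            using G(2) x iF(1,3) PS by blast
          moreover have "x \<in> S" "finite (G \<union> F k)"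
            using x iF(1,2) PS G(1) by auto
          ultimately show ?thesis
            using Suc.prems(2) by (simp add: good_def)
        qed
        ultimately show "(\<Sum>j\<in>G. a x j) \<le> real n * \<epsilon>"
          using iF(4)[of k] x by (simp add: algebra_simps)
      qed
      then show ?thesis
        using Suc.IH[of "range i"] range_inj_infinite[OF \<open>inj i\<close>] by blast
    qed
  qed
  obtain n where "C < real n * \<epsilon>"
    using reals_Archimedean3[OF \<open>0 < \<epsilon>\<close>] by blast
  then have "good (real n * \<epsilon>) UNIV"
    unfolding good_def using bdd by (meson less_imp_le order_trans)
  then obtain M where "infinite M" "good \<epsilon> M"
    using step[of UNIV n] by auto
  then show thesis
    using that[of M] by (auto simp: good_def)
qed

text \<open>Weak topologies need not be first countable, so compactness is used through cluster
  points and not through subsequences. Without a cluster point, finitely many open sets, each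
  eventually avoided by the sequence, would cover \<open>K\<close>.\<close>

lemma compactin_sequence_cluster_point:
  fixes u :: "nat \<Rightarrow> 'b"
  assumes K: "compactin T K" and u: "\<And>m. u m \<in> K"
  obtains v where "v \<in> K" "\<And>U n. openin T U \<Longrightarrow> v \<in> U \<Longrightarrow> \<exists>m\<ge>n. u m \<in> U"
proof -
  have "\<exists>v\<in>K. \<forall>U n. openin T U \<longrightarrow> v \<in> U \<longrightarrow> (\<exists>m\<ge>n. u m \<in> U)"
  proof (rule ccontr)
    assume "\<not> ?thesis"
    then have "\<forall>v\<in>K. \<exists>U. openin T U \<and> v \<in> U \<and> (\<forall>\<^sub>F m in sequentially. u m \<notin> U)"
      by (auto simp: eventually_sequentially)
    then have "K \<subseteq> \<Union>{U. openin T U \<and> (\<forall>\<^sub>F m in sequentially. u m \<notin> U)}"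
      by auto
    then have "\<exists>\<F>. finite \<F> \<and> \<F> \<subseteq> {U. openin T U \<and> (\<forall>\<^sub>F m in sequentially. u m \<notin> U)} \<and> K \<subseteq> \<Union>\<F>"
      by (intro compactinD[OF K]) simp_all
    then obtain \<F> where \<F>: "finite \<F>" "K \<subseteq> \<Union>\<F>" "\<And>U. U \<in> \<F> \<Longrightarrow> \<forall>\<^sub>F m in sequentially. u m \<notin> U"
      by (elim exE conjE) (simp add: subset_eq)
    have "\<forall>\<^sub>F m in sequentially. \<forall>U\<in>\<F>. u m \<notin> U"
      using \<F>(1,3) by (simp add: eventually_ball_finite)
    then obtain m where "\<forall>U\<in>\<F>. u m \<notin> U"
      by (auto simp: eventually_sequentially)
    then show False
      using u[of m] \<F>(2) by blast
  qed
  then show thesis using that by blast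
qed

text \<open>Tychonoff's theorem for the product of the discs of radius \<open>B f\<close>, as in the
  Banach-Alaoglu theorem. The finite sets \<open>G\<close> reflect that a basic open set of the
  product restricts finitely many coordinates.\<close>

lemma pointwise_bounded_cluster_point:
  fixes x :: "nat \<Rightarrow> 'b \<Rightarrow> complex"
  assumes "\<And>i f. f \<in> X \<Longrightarrow> cmod (x i f) \<le> B f"
  obtains l where "\<And>G \<epsilon> n. finite G \<Longrightarrow> G \<subseteq> X \<Longrightarrow> 0 < \<epsilon> \<Longrightarrow> \<exists>i\<ge>n. \<forall>f\<in>G. cmod (x i f - l f) < \<epsilon>"
proof -
  let ?T = "product_topology (\<lambda>_. euclidean :: complex topology) X"
  have K: "compactin ?T (PiE X (\<lambda>f. cball 0 (B f)))"
    by (auto simp: compactin_PiE)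
  have "restrict (x i) X \<in> PiE X (\<lambda>f. cball 0 (B f))" for i
    using assms by auto
  then obtain l where l: "\<And>U n. openin ?T U \<Longrightarrow> l \<in> U \<Longrightarrow> \<exists>m\<ge>n. restrict (x m) X \<in> U"
      and lP: "l \<in> PiE X (\<lambda>f. cball 0 (B f))"
    using compactin_sequence_cluster_point[OF K, of "\<lambda>i. restrict (x i) X"] by metis
  show thesis
  proof (rule that[of l])
    fix G and \<epsilon> :: real and n
    assume G: "finite G" "G \<subseteq> X" and "0 < \<epsilon>"
    let ?U = "PiE X (\<lambda>f. if f \<in> G then ball (l f) \<epsilon> else UNIV)"
    have "openin ?T ?U"
      by (rule product_topology_basis) (auto intro!: finite_subset[OF _ G(1)])
    moreover have "l \<in> ?U"
      using lP \<open>0 < \<epsilon>\<close> by (auto simp: PiE_iff)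
    ultimately obtain m where "m \<ge> n" and m: "restrict (x m) X \<in> ?U"
      using l by blast
    have "cmod (x m f - l f) < \<epsilon>" if "f \<in> G" for f
    proof -
      have "restrict (x m) X f \<in> ball (l f) \<epsilon>"
        using PiE_mem[OF m, of f] that G(2) by auto
      then show ?thesis
        using that G(2) by (auto simp: dist_norm norm_minus_commute)
    qed
    with \<open>m \<ge> n\<close> show "\<exists>i\<ge>n. \<forall>f\<in>G. cmod (x i f - l f) < \<epsilon>" by blast
  qed
qed

lemma openin_weak_topology_basic:
  "l \<in> fun_dual X N \<Longrightarrow> open U \<Longrightarrow> openin (weak_topology X N) {f\<in>X. l f \<in> U}"
  unfolding weak_topology_def by (rule topology_generated_by_Basis) blast

lemma topspace_weak_topology: "topspace (weak_topology X N) = X"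
proof -
  have "(\<lambda>_. 0) \<in> fun_dual X N"
    by (auto simp: fun_dual_def intro!: exI[of _ 0])
  then have "openin (weak_topology X N) X"
    using openin_weak_topology_basic[of "\<lambda>_. 0" X N UNIV] by simp
  moreover have "topspace (weak_topology X N) \<subseteq> X"
    unfolding weak_topology_def topology_generated_by_topspace by blast
  ultimately show ?thesis
    using openin_subset by blast
qed

text \<open>Every weak cluster point is the pointwise limit, because point evaluations are functionals.\<close>

lemma weakly_compact_pointwise_limit:
  fixes u :: "nat \<Rightarrow> 'a \<Rightarrow> complex"
  assumes K: "compactin (weak_topology Y N) K" and uK: "\<And>m. u m \<in> K"
    and ev: "\<And>z. (\<lambda>f. f z) \<in> fun_dual Y N"
    and pt: "\<And>z. (\<lambda>m. u m z) \<longlonglongrightarrow> v z"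
    and l: "l \<in> fun_dual Y N" and conv: "convergent (\<lambda>m. l (u m))"
  shows "(\<lambda>m. l (u m)) \<longlonglongrightarrow> l v"
proof -
  obtain y where yK: "y \<in> K"
    and y: "\<And>U n. openin (weak_topology Y N) U \<Longrightarrow> y \<in> U \<Longrightarrow> \<exists>m\<ge>n. u m \<in> U"
    using compactin_sequence_cluster_point[where u = u, OF K uK] by blast
  have yY: "y \<in> Y"
    using yK K compactin_subset_topspace topspace_weak_topology by blast
  \<comment> \<open>If \<open>k (u m)\<close> converges, its limit is the value at the cluster
    point. For point evaluations this identifies \<open>y\<close> with \<open>v\<close>; for
    \<open>l\<close> it then gives the claim.\<close>
  have lim: "c = k y" if k: "k \<in> fun_dual Y N" and c: "(\<lambda>m. k (u m)) \<longlonglongrightarrow> c" for k c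
  proof (rule ccontr)
    assume "c \<noteq> k y"
    then obtain U V where UV: "open U" "open V" "c \<in> U" "k y \<in> V" "U \<inter> V = {}"
      by (metis hausdorff)
    obtain n where n: "\<And>m. m \<ge> n \<Longrightarrow> k (u m) \<in> U"
      using topological_tendstoD[OF c UV(1,3)] by (auto simp: eventually_sequentially)
    obtain m where "m \<ge> n" "u m \<in> {f\<in>Y. k f \<in> V}"
      using y[OF openin_weak_topology_basic[OF k UV(2)]] yY UV(4) by blast
    then show False using n UV(5) by blast
  qed
  have "v = y"
    using lim[OF ev pt] by blast
  then show ?thesis
    using conv lim[OF l] by (auto simp: convergent_def)
qed

definition seq_unit :: "nat \<Rightarrow> nat \<Rightarrow> complex" where
  "seq_unit i = (\<lambda>j. if j = i then 1 else 0)"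

text \<open>Weakly compact operators on \<open>\<ell>\<^sup>\<infinity>\<close> are unconditionally
  converging. Rosenthal's lemma makes the matrix \<open>l i (V (seq_unit j))\<close> almost diagonal on an
  infinite set \<open>M\<close> of indices; a pointwise cluster point \<open>l\<close> of the functionals then is almost zero on
  the image of the indicator of \<open>M\<close>, although each \<open>l i\<close> with \<open>i \<in> M\<close> is not.\<close>

lemma weakly_compact_linfinity_null:
  fixes V :: "(nat \<Rightarrow> complex) \<Rightarrow> ('a \<Rightarrow> complex)"
  assumes ev: "\<And>z. (\<lambda>f. f z) \<in> fun_dual Y N"
    and nonneg: "\<And>f. f \<in> Y \<Longrightarrow> 0 \<le> N f"
    and closed_add: "\<And>f g. f \<in> Y \<Longrightarrow> g \<in> Y \<Longrightarrow> (\<lambda>x. f x + g x) \<in> Y"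
    and closed_scale: "\<And>f c. f \<in> Y \<Longrightarrow> (\<lambda>x. c * f x) \<in> Y"
    and VY: "\<And>w B. (\<And>j. cmod (w j) \<le> B) \<Longrightarrow> V w \<in> Y"
    and add: "\<And>u w B. (\<And>j. cmod (u j) \<le> B) \<Longrightarrow> (\<And>j. cmod (w j) \<le> B) \<Longrightarrow>
        V (\<lambda>j. u j + w j) = (\<lambda>x. V u x + V w x)"
    and scale: "\<And>w B c. (\<And>j. cmod (w j) \<le> B) \<Longrightarrow> V (\<lambda>j. c * w j) = (\<lambda>x. c * V w x)"
    and bdd: "\<And>w. (\<And>j. cmod (w j) \<le> 1) \<Longrightarrow> N (V w) \<le> C"
    and K: "compactin (weak_topology Y N) K"
    and VK: "\<And>w. (\<And>j. cmod (w j) \<le> 1) \<Longrightarrow> V w \<in> K"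
    and pt: "\<And>w x. (\<And>j. cmod (w j) \<le> 1) \<Longrightarrow> (\<lambda>m. V (\<lambda>j. if j < m then w j else 0) x) \<longlonglongrightarrow> V w x"
    and l: "\<And>i. l i \<in> fun_dual Y N" and lbdd: "\<And>i f. f \<in> Y \<Longrightarrow> cmod (l i f) \<le> L * N f"
    and "0 < \<delta>"
  shows "\<exists>i. cmod (l i (V (seq_unit i))) < \<delta>"
proof -
  let ?e = seq_unit
  have e_le: "cmod (?e i j) \<le> 1" for i j
    by (simp add: seq_unit_def)
  have fin: "k (V (\<lambda>j. if j \<in> F then w j else 0)) = (\<Sum>j\<in>F. w j * k (V (?e j)))"
    if k: "k \<in> fun_dual Y N" and F: "finite F" for k F w
    using F
  proof (induction F)
    case empty
    have "V (\<lambda>j. 0 * 0) = (\<lambda>x. 0 * V (\<lambda>_. 0) x)"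
      by (rule scale[of _ 0]) auto
    moreover have "k (\<lambda>x. 0 * V (\<lambda>_. 0) x) = 0 * k (V (\<lambda>_. 0))"
      using k VY[of "\<lambda>_. 0" 0, simplified] unfolding fun_dual_def by blast
    ultimately show ?case by simp
  next
    case (insert i F)
    define B where "B = Max (cmod ` w ` insert i F)"
    have B: "cmod (w j) \<le> B" if "j \<in> insert i F" for j
      using that insert.hyps(1) by (auto simp: B_def intro: Max_ge)
    then have B0: "0 \<le> B"
      by (meson insertI1 norm_ge_zero order_trans)
    let ?u = "\<lambda>j. if j \<in> F then w j else 0" and ?v = "\<lambda>j. w i * ?e i j"
    have u: "cmod (?u j) \<le> B" and v: "cmod (?v j) \<le> B" for j
      using B B0 by (auto simp: seq_unit_def)
    have "(\<lambda>j. if j \<in> insert i F then w j else 0) = (\<lambda>j. ?u j + ?v j)"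
      using insert.hyps by (auto simp: seq_unit_def)
    then have "k (V (\<lambda>j. if j \<in> insert i F then w j else 0)) = k (V ?u) + k (V ?v)"
      using add[OF u v] VY[OF u] VY[OF v] k by (auto simp: fun_dual_def)
    also have "k (V ?v) = w i * k (V (?e i))"
      using scale[of "?e i" 1 "w i", OF e_le] VY[of "?e i" 1, OF e_le] k by (auto simp: fun_dual_def)
    finally show ?case
      using insert by simp
  qed
  have row: "(\<Sum>j\<in>F. cmod (k (V (?e j)))) \<le> \<bar>D\<bar> * C"
    if k: "k \<in> fun_dual Y N" and D: "\<And>f. f \<in> Y \<Longrightarrow> cmod (k f) \<le> D * N f" and F: "finite F" for k D F
  proof -
    \<comment> \<open>Conjugate phases turn every summand into its modulus, so the row sum is the
      value of \<open>k\<close> at the image of one sequence bounded by 1.\<close>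
    define w where "w j = cnj (sgn (k (V (?e j))))" for j
    have w: "cmod (if j \<in> F then w j else 0) \<le> 1" for j
      by (auto simp: w_def norm_sgn)
    let ?y = "V (\<lambda>j. if j \<in> F then w j else 0)"
    have "w j * k (V (?e j)) = complex_of_real (cmod (k (V (?e j))))" for j
      by (simp add: w_def sgn_eq complex_norm_square[symmetric] power2_eq_square mult.commute)
    then have "complex_of_real (\<Sum>j\<in>F. cmod (k (V (?e j)))) = k ?y"
      using fin[OF k F] by simp
    then have "cmod (k ?y) = \<bar>\<Sum>j\<in>F. cmod (k (V (?e j)))\<bar>"
      using norm_of_real by metis
    then have "(\<Sum>j\<in>F. cmod (k (V (?e j)))) = cmod (k ?y)"
      by (simp add: sum_nonneg)
    also have "\<dots> \<le> D * N ?y"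
      by (rule D[OF VY[OF w]])
    also have "\<dots> \<le> \<bar>D\<bar> * C"
      using bdd[OF w] nonneg[OF VY[OF w]] by (intro mult_mono) auto
    finally show ?thesis .
  qed
  \<comment> \<open>Weak compactness enters here. A bounded functional on bounded sequences can
    vanish on all finitely supported ones without being zero. The images of the truncations of
    \<open>w\<close>, however, stay in \<open>K\<close> and converge pointwise to
    \<open>V w\<close>, which forces the series to have the sum \<open>k (V w)\<close>.\<close>
  have lim: "(\<lambda>m. \<Sum>j<m. w j * k (V (?e j))) \<longlonglongrightarrow> k (V w)"
    if k: "k \<in> fun_dual Y N" and w: "\<And>j. cmod (w j) \<le> 1" for k w
  proof -
    obtain D where D: "\<And>f. f \<in> Y \<Longrightarrow> cmod (k f) \<le> D * N f"
      using k unfolding fun_dual_def by blast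
    have "summable (\<lambda>j. cmod (k (V (?e j))))"
      by (rule summableI_nonneg_bounded[where x="\<bar>D\<bar> * C"]) (auto intro: row[OF k D])
    then have "summable (\<lambda>j. w j * k (V (?e j)))"
      by (rule summable_comparison_test[rotated])
        (use w in \<open>auto simp: norm_mult intro!: mult_left_le_one_le exI[of _ 0]\<close>)
    then have *: "convergent (\<lambda>m. \<Sum>j<m. w j * k (V (?e j)))"
      by (simp add: summable_iff_convergent)
    have cut: "k (V (\<lambda>j. if j < m then w j else 0)) = (\<Sum>j<m. w j * k (V (?e j)))" for m
      using fin[OF k, of "{..<m}" w] by simp
    have "(\<lambda>m. k (V (\<lambda>j. if j < m then w j else 0))) \<longlonglongrightarrow> k (V w)"
      using * w by (intro weakly_compact_pointwise_limit[OF K _ ev pt k]) (auto simp: cut intro!: VK)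
    then show ?thesis by (simp add: cut)
  qed
  show ?thesis
  proof (rule ccontr)
    assume "\<not> ?thesis"
    then have big: "\<delta> \<le> cmod (l i (V (?e i)))" for i
      by (simp add: not_less)
    \<comment> \<open>In units of delta: the limit functional is at most 1/8 + 1/8 = 1/4 on the
      image of the indicator of \<open>M\<close>, every \<open>l i\<close> with \<open>i\<close> in
      \<open>M\<close> is at least 1 - 1/8 there, and for some such \<open>i\<close> the two values
      differ by less than 1/8.\<close>
    obtain M where M: "infinite M"
      and MF: "\<And>i F. i \<in> M \<Longrightarrow> finite F \<Longrightarrow> F \<subseteq> M - {i} \<Longrightarrow> (\<Sum>j\<in>F. cmod (l i (V (?e j)))) \<le> \<delta> / 8"
      using rosenthal_infinite_subset[of "\<lambda>i j. cmod (l i (V (?e j)))" "\<bar>L\<bar> * C" "\<delta> / 8"]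
        row[OF l lbdd] \<open>0 < \<delta>\<close> by auto
    define w where "w j = (if j \<in> M then 1 else (0::complex))" for j
    have w: "cmod (w j) \<le> 1" for j
      by (simp add: w_def)
    have sumw: "(\<Sum>j<m. w j * k (V (?e j))) = (\<Sum>j\<in>{..<m} \<inter> M. k (V (?e j)))" for k m
      by (simp add: w_def sum.inter_restrict if_distrib[of "\<lambda>x. x * _"] cong: if_cong)
    obtain k where k: "\<And>G \<epsilon> n. finite G \<Longrightarrow> G \<subseteq> Y \<Longrightarrow> 0 < \<epsilon> \<Longrightarrow>
        \<exists>i\<ge>n. \<forall>f\<in>G. cmod (l (enumerate M i) f - k f) < \<epsilon>"
      using pointwise_bounded_cluster_point[of Y "\<lambda>i. l (enumerate M i)" "\<lambda>f. L * N f"] lbdd by metis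
    \<comment> \<open>Since \<open>enumerate M i\<close> is at least \<open>i\<close>, the
      approximating index can be taken in \<open>M\<close> and beyond any given bound.\<close>
    have kM: "\<exists>i\<in>M. n \<le> i \<and> (\<forall>f\<in>G. cmod (l i f - k f) < \<epsilon>)"
      if "finite G" "G \<subseteq> Y" "0 < \<epsilon>" for G \<epsilon> n
      using k[OF that, of n] le_enumerate[OF M] enumerate_in_set[OF M] by (meson order_trans)
    have kdual: "k \<in> fun_dual Y N"
      unfolding fun_dual_def
    proof (intro CollectI conjI ballI allI exI[of _ L])
      fix f g assume fg: "f \<in> Y" "g \<in> Y"
      have "cmod (k (\<lambda>x. f x + g x) - (k f + k g)) \<le> 0"
      proof (rule field_le_epsilon)
        fix \<eta> :: real assume "0 < \<eta>"
        then obtain i where i: "cmod (l i f - k f) < \<eta> / 3" "cmod (l i g - k g) < \<eta> / 3"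
            "cmod (l i (\<lambda>x. f x + g x) - k (\<lambda>x. f x + g x)) < \<eta> / 3"
          using kM[of "{f, g, \<lambda>x. f x + g x}" "\<eta> / 3" 0] fg closed_add[OF fg] by auto
        have "l i (\<lambda>x. f x + g x) = l i f + l i g"
          using l[of i] fg by (auto simp: fun_dual_def)
        then have eq: "k (\<lambda>x. f x + g x) - (k f + k g) =
            (l i f - k f) + (l i g - k g) - (l i (\<lambda>x. f x + g x) - k (\<lambda>x. f x + g x))"
          by simp
        show "cmod (k (\<lambda>x. f x + g x) - (k f + k g)) \<le> 0 + \<eta>"
          unfolding eq
          using norm_triangle_ineq4[of "(l i f - k f) + (l i g - k g)"
              "l i (\<lambda>x. f x + g x) - k (\<lambda>x. f x + g x)"]
            norm_triangle_ineq[of "l i f - k f" "l i g - k g"] i by linarith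
      qed
      then show "k (\<lambda>x. f x + g x) = k f + k g" by simp
    next
      fix c f assume f: "f \<in> Y"
      have "cmod (k (\<lambda>x. c * f x) - c * k f) \<le> 0"
      proof (rule field_le_epsilon)
        fix \<eta> :: real assume "0 < \<eta>"
        define \<theta> where "\<theta> = \<eta> / (1 + cmod c)"
        have \<theta>: "0 < \<theta>" "\<theta> * (1 + cmod c) = \<eta>"
          using \<open>0 < \<eta>\<close> by (auto simp: \<theta>_def add_nonneg_eq_0_iff add_pos_nonneg)
        obtain i where i: "cmod (l i f - k f) < \<theta>"
            "cmod (l i (\<lambda>x. c * f x) - k (\<lambda>x. c * f x)) < \<theta>"
          using kM[of "{f, \<lambda>x. c * f x}" \<theta> 0] f closed_scale[OF f] \<theta>(1) by auto
        have "l i (\<lambda>x. c * f x) = c * l i f"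
          using l[of i] f by (auto simp: fun_dual_def)
        then have eq: "k (\<lambda>x. c * f x) - c * k f =
            c * (l i f - k f) - (l i (\<lambda>x. c * f x) - k (\<lambda>x. c * f x))"
          by (simp add: algebra_simps)
        have "cmod (c * (l i f - k f)) \<le> cmod c * \<theta>"
          using i(1) by (simp add: norm_mult mult_left_mono)
        then show "cmod (k (\<lambda>x. c * f x) - c * k f) \<le> 0 + \<eta>"
          unfolding eq
          using norm_triangle_ineq4[of "c * (l i f - k f)" "l i (\<lambda>x. c * f x) - k (\<lambda>x. c * f x)"]
            i(2) \<theta>(2) by (simp add: algebra_simps)
      qed
      then show "k (\<lambda>x. c * f x) = c * k f" by simp
    next
      fix f assume f: "f \<in> Y"
      show "cmod (k f) \<le> L * N f"
      proof (rule field_le_epsilon)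
        fix \<eta> :: real assume "0 < \<eta>"
        then obtain i where i: "cmod (l i f - k f) < \<eta>"
          using kM[of "{f}" \<eta> 0] f by auto
        then show "cmod (k f) \<le> L * N f + \<eta>"
          using lbdd[OF f, of i] norm_triangle_ineq2[of "k f" "l i f"] by (simp add: norm_minus_commute)
      qed
    qed
    have ksum: "(\<Sum>j\<in>F. cmod (k (V (?e j)))) \<le> \<delta> / 4" if F: "finite F" "F \<subseteq> M" for F
    proof -
      define \<eta> where "\<eta> = \<delta> / 8 / (1 + card F)"
      have \<eta>: "0 < \<eta>" "card F * \<eta> \<le> \<delta> / 8"
        using \<open>0 < \<delta>\<close> by (auto simp: \<eta>_def field_simps)
      have "(\<lambda>j. V (?e j)) ` F \<subseteq> Y"
        using VY[of "?e _" 1] e_le by blast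
      \<comment> \<open>An index of \<open>M\<close> beyond all of \<open>F\<close> makes every
        entry of \<open>F\<close> off-diagonal, so the bound from Rosenthal's lemma covers the whole
        sum. The inserted 0 keeps \<open>Max\<close> meaningful for empty \<open>F\<close>.\<close>
      then obtain i where i: "i \<in> M" "i \<ge> Suc (Max (insert 0 F))"
          and i2: "\<And>j. j \<in> F \<Longrightarrow> cmod (l i (V (?e j)) - k (V (?e j))) < \<eta>"
        using kM[of "(\<lambda>j. V (?e j)) ` F" \<eta> "Suc (Max (insert 0 F))"] F(1) \<eta>(1) by auto
      have "i \<notin> F"
        using i(2) F(1) by (meson Max_ge Suc_n_not_le_n finite.insertI insertCI order_trans)
      have "(\<Sum>j\<in>F. cmod (k (V (?e j)))) \<le> (\<Sum>j\<in>F. cmod (l i (V (?e j))) + \<eta>)"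
      proof (rule sum_mono)
        fix j assume "j \<in> F"
        then show "cmod (k (V (?e j))) \<le> cmod (l i (V (?e j))) + \<eta>"
          using i2[of j] norm_triangle_ineq2[of "k (V (?e j))" "l i (V (?e j))"]
          by (simp add: norm_minus_commute)
      qed
      also have "\<dots> = (\<Sum>j\<in>F. cmod (l i (V (?e j)))) + card F * \<eta>"
        by (simp add: sum.distrib)
      also have "\<dots> \<le> \<delta> / 8 + \<delta> / 8"
        using MF[OF i(1) F(1)] F(2) \<open>i \<notin> F\<close> \<eta>(2) by (intro add_mono) auto
      finally show ?thesis by simp
    qed
    have upper: "cmod (k (V w)) \<le> \<delta> / 4"
    proof (rule Lim_bounded[OF tendsto_norm[OF lim[OF kdual w]]], intro allI impI)
      fix m
      show "cmod (\<Sum>j<m. w j * k (V (?e j))) \<le> \<delta> / 4"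
        unfolding sumw by (rule order_trans[OF norm_sum ksum]) auto
    qed
    obtain i where i: "i \<in> M" "cmod (l i (V w) - k (V w)) < \<delta> / 8"
      using kM[of "{V w}" "\<delta> / 8" 0] VY[OF w] \<open>0 < \<delta>\<close> by auto
    have "\<delta> - \<delta> / 8 \<le> cmod (l i (V w))"
    proof (rule Lim_bounded2[OF tendsto_norm[OF lim[OF l w]], of "Suc i"], intro allI impI)
      fix m assume "m \<ge> Suc i"
      let ?A = "{..<m} \<inter> M - {i}"
      have "{..<m} \<inter> M = insert i ?A"
        using i(1) \<open>m \<ge> Suc i\<close> by auto
      then have eq: "(\<Sum>j\<in>{..<m} \<inter> M. l i (V (?e j))) = l i (V (?e i)) + (\<Sum>j\<in>?A. l i (V (?e j)))"
        by (metis DiffE finite_Diff finite_Int finite_lessThan insertI1 sum.insert)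
      have "cmod (\<Sum>j\<in>?A. l i (V (?e j))) \<le> \<delta> / 8"
        by (rule order_trans[OF norm_sum MF[OF i(1)]]) auto
      then show "\<delta> - \<delta> / 8 \<le> cmod (\<Sum>j<m. w j * l i (V (?e j)))"
        unfolding sumw eq using big[of i] norm_diff_ineq[of "l i (V (?e i))" "\<Sum>j\<in>?A. l i (V (?e j))"]
        by linarith
    qed
    then show False
      using i(2) upper norm_triangle_ineq2[of "l i (V w)" "k (V w)"] \<open>0 < \<delta>\<close> by linarith
  qed
qed

section \<open>Norm and weak topologies of function spaces\<close>

lemma
  assumes "normed_fun_space Y N" "f \<in> Y"
  shows normed_fun_space_scale: "(\<lambda>x. c * f x) \<in> Y"
    and normed_fun_space_add: "g \<in> Y \<Longrightarrow> (\<lambda>x. f x + g x) \<in> Y"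
    and normed_fun_space_triangle: "g \<in> Y \<Longrightarrow> N (\<lambda>x. f x + g x) \<le> N f + N g"
  using assms by (simp_all add: normed_fun_space_def)

lemma
  assumes "l \<in> fun_dual Y N" "f \<in> Y"
  shows fun_dual_scale: "l (\<lambda>x. c * f x) = c * l f"
    and fun_dual_add: "g \<in> Y \<Longrightarrow> l (\<lambda>x. f x + g x) = l f + l g"
  using assms by (simp_all add: fun_dual_def)

lemma normed_fun_space_diff:
  assumes "normed_fun_space Y N" "f \<in> Y" "g \<in> Y"
  shows "(\<lambda>x. f x - g x) \<in> Y"
  using normed_fun_space_add[OF assms(1,2) normed_fun_space_scale[OF assms(1,3), of "- 1"]] by simp

text \<open>\<open>Metric_space\<close> demands nonnegativity and symmetry of the distance off the
  carrier as well, which is why both assumptions on \<open>N\<close> range over all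
  functions.\<close>

lemma Metric_space_fun_dist:
  assumes Y: "normed_fun_space Y N" and nonneg: "\<And>f. 0 \<le> N f" and minus: "\<And>f. N (\<lambda>x. - f x) = N f"
  shows "Metric_space Y (fun_dist N)"
proof
  show "0 \<le> fun_dist N f g" for f g
    by (simp add: fun_dist_def nonneg)
  show "fun_dist N f g = fun_dist N g f" for f g
    using minus[of "\<lambda>x. f x - g x"] by (simp add: fun_dist_def)
  note diff = normed_fun_space_diff[OF Y]
  show "fun_dist N f g = 0 \<longleftrightarrow> f = g" if "f \<in> Y" "g \<in> Y" for f g
    using Y diff[OF that] by (auto simp: fun_dist_def normed_fun_space_def fun_eq_iff)
  show "fun_dist N f h \<le> fun_dist N f g + fun_dist N g h" if "f \<in> Y" "g \<in> Y" "h \<in> Y" for f g h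
  proof -
    have "N (\<lambda>x. (f x - g x) + (g x - h x)) \<le> N (\<lambda>x. f x - g x) + N (\<lambda>x. g x - h x)"
      by (rule normed_fun_space_triangle[OF Y diff[OF that(1,2)] diff[OF that(2,3)]])
    then show ?thesis
      by (simp add: fun_dist_def)
  qed
qed

lemma Hausdorff_weak_topology:
  assumes "\<And>z. (\<lambda>f. f z) \<in> fun_dual Y N"
  shows "Hausdorff_space (weak_topology Y N)"
  unfolding Hausdorff_space_def topspace_weak_topology
proof (intro allI impI)
  fix f g assume fg: "f \<in> Y \<and> g \<in> Y \<and> f \<noteq> g"
  then obtain z where "f z \<noteq> g z"
    by blast
  then obtain U V where UV: "open U" "open V" "f z \<in> U" "g z \<in> V" "U \<inter> V = {}"
    by (metis hausdorff)
  have "openin (weak_topology Y N) {h \<in> Y. h z \<in> U}" "openin (weak_topology Y N) {h \<in> Y. h z \<in> V}"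
    using openin_weak_topology_basic[OF assms] UV by blast+
  then show "\<exists>U V. openin (weak_topology Y N) U \<and> openin (weak_topology Y N) V \<and> f \<in> U \<and> g \<in> V \<and> disjnt U V"
    using fg UV by (intro exI[of _ "{h \<in> Y. h z \<in> U}"] exI[of _ "{h \<in> Y. h z \<in> V}"]) (auto simp: disjnt_def)
qed

lemma continuous_map_norm_weak:
  assumes Y: "normed_fun_space Y N" and met: "Metric_space Y (fun_dist N)"
  shows "continuous_map (norm_topology Y N) (weak_topology Y N) id"
proof -
  interpret Metric_space Y "fun_dist N" by (rule met)
  have top: "topspace (norm_topology Y N) = Y"
    by (simp add: norm_topology_def)
  show ?thesis
    unfolding weak_topology_def
  proof (rule continuous_on_generated_topo)
    fix W assume "W \<in> {{f \<in> Y. l f \<in> U} | l U. l \<in> fun_dual Y N \<and> open U}"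
    then obtain l U where W: "W = {f \<in> Y. l f \<in> U}" and l: "l \<in> fun_dual Y N" and U: "open U"
      by blast
    obtain C where C: "\<And>f. f \<in> Y \<Longrightarrow> cmod (l f) \<le> C * N f"
      using l unfolding fun_dual_def by blast
    have "\<exists>r>0. mball f r \<subseteq> W" if f: "f \<in> W" for f
    proof -
      have fY: "f \<in> Y" and "l f \<in> U"
        using f W by auto
      then obtain e where e: "0 < e" "ball (l f) e \<subseteq> U"
        using U open_contains_ball by blast
      have "g \<in> W" if g: "g \<in> mball f (e / (\<bar>C\<bar> + 1))" for g
      proof -
        have gY: "g \<in> Y" and d: "N (\<lambda>x. f x - g x) < e / (\<bar>C\<bar> + 1)"
          using g by (auto simp: fun_dist_def)
        have neg: "(\<lambda>x. - 1 * g x) \<in> Y"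
          by (rule normed_fun_space_scale[OF Y gY])
        have diff: "(\<lambda>x. f x + - 1 * g x) \<in> Y"
          by (rule normed_fun_space_add[OF Y fY neg])
        have "l (\<lambda>x. f x + - 1 * g x) = l f + - 1 * l g"
          unfolding fun_dual_add[OF l fY neg] fun_dual_scale[OF l gY] ..
        then have "cmod (l f - l g) \<le> C * N (\<lambda>x. f x - g x)"
          using C[OF diff] by simp
        also have "\<dots> \<le> (\<bar>C\<bar> + 1) * N (\<lambda>x. f x - g x)"
          using nonneg[of f g] by (intro mult_right_mono) (auto simp: fun_dist_def)
        also have "\<dots> < e"
          using d by (simp add: pos_less_divide_eq mult.commute)
        finally have "l g \<in> U"
          using e(2) by (auto simp: dist_norm)
        then show ?thesis
          using W gY by simp
      qed
      then show ?thesis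
        using e(1) by (intro exI[of _ "e / (\<bar>C\<bar> + 1)"]) (auto simp del: in_mball)
    qed
    then have "openin mtopology W"
      unfolding openin_mtopology using W by blast
    moreover have "id -` W \<inter> Y = W"
      using W by auto
    ultimately show "openin (norm_topology Y N) (id -` W \<inter> topspace (norm_topology Y N))"
      unfolding top by (simp add: norm_topology_def)
  next
    show "id ` topspace (norm_topology Y N) \<subseteq> \<Union>{{f \<in> Y. l f \<in> U} | l U. l \<in> fun_dual Y N \<and> open U}"
      using topspace_weak_topology[of Y N] unfolding top weak_topology_def topology_generated_by_topspace by simp
  qed
qed

lemma compact_operator_imp_weakly_compact:
  assumes Y: "normed_fun_space Y N" and met: "Metric_space Y (fun_dist N)"
    and ev: "\<And>z. (\<lambda>f. f z) \<in> fun_dual Y N"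
    and T: "compact_operator X N' Y N T"
  shows "weakly_compact_operator X N' Y N T"
proof -
  let ?B = "T ` {f \<in> X. N' f \<le> 1}"
  let ?K = "norm_topology Y N closure_of ?B"
  have "compactin (norm_topology Y N) ?K" and bo: "bounded_operator X N' Y N T"
    using T by (auto simp: compact_operator_def)
  then have K: "compactin (weak_topology Y N) ?K"
    using image_compactin[OF _ continuous_map_norm_weak[OF Y met]] by fastforce
  have "?B \<subseteq> topspace (norm_topology Y N)"
    using bo by (auto simp: bounded_operator_def norm_topology_def Metric_space.topspace_mtopology[OF met])
  \<comment> \<open>The norm closure is weakly compact, hence weakly closed in a Hausdorff topology,
    and so it contains the weak closure.\<close>
  then have "weak_topology Y N closure_of ?B \<subseteq> ?K"
    by (intro closure_of_minimal closure_of_subset compactin_imp_closedin Hausdorff_weak_topology ev K)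
  then have "compactin (weak_topology Y N) (weak_topology Y N closure_of ?B)"
    using K by (intro closed_compactin[OF K]) auto
  with bo show ?thesis
    by (simp add: weakly_compact_operator_def)
qed

section \<open>The space \<open>M(D\<^sup>p\<^sub>\<mu>)\<close>\<close>

lemma disk_autD:
  assumes "\<sigma> \<in> disk_aut"
  shows "\<sigma> holomorphic_on unit_disk" "\<And>z. z \<in> unit_disk \<Longrightarrow> \<sigma> z \<in> unit_disk"
  using assms bij_betwE[of \<sigma> unit_disk unit_disk] by (auto simp: disk_aut_def)

lemma id_in_disk_aut: "id \<in> disk_aut"
  by (auto simp: disk_aut_def)

lemma disk_analytic_holomorphic: "f \<in> disk_analytic \<Longrightarrow> f holomorphic_on unit_disk"
  by (simp add: disk_analytic_def)

lemma holomorphic_comp_aut: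
  "f \<in> disk_analytic \<Longrightarrow> \<sigma> \<in> disk_aut \<Longrightarrow> (f \<circ> \<sigma>) holomorphic_on unit_disk"
  by (rule holomorphic_on_compose_gen[of _ _ _ unit_disk])
     (use disk_autD in \<open>auto simp: disk_analytic_def\<close>)

lemma differentiable_comp_aut:
  "f \<in> disk_analytic \<Longrightarrow> \<sigma> \<in> disk_aut \<Longrightarrow> z \<in> unit_disk \<Longrightarrow> (f \<circ> \<sigma>) field_differentiable at z"
  using holomorphic_comp_aut holomorphic_on_imp_differentiable_at open_ball by blast

lemma disk_analytic_add: "f \<in> disk_analytic \<Longrightarrow> g \<in> disk_analytic \<Longrightarrow> (\<lambda>z. f z + g z) \<in> disk_analytic"
  by (auto simp: disk_analytic_def intro!: holomorphic_intros)

lemma disk_analytic_scale: "f \<in> disk_analytic \<Longrightarrow> (\<lambda>z. c * f z) \<in> disk_analytic"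
  by (auto simp: disk_analytic_def intro!: holomorphic_intros)

lemma powr_inverse_le_iff:
  fixes x c p :: real
  assumes "0 \<le> x" "0 \<le> c" "0 < p"
  shows "x powr (1 / p) \<le> c \<longleftrightarrow> x \<le> c powr p"
proof
  assume "x powr (1 / p) \<le> c"
  then have "(x powr (1 / p)) powr p \<le> c powr p"
    using assms by (intro powr_mono2) auto
  then show "x \<le> c powr p"
    using assms by (simp add: powr_powr)
next
  assume "x \<le> c powr p"
  then have "x powr (1 / p) \<le> (c powr p) powr (1 / p)"
    using assms by (intro powr_mono2) auto
  then show "x powr (1 / p) \<le> c"
    using assms by (simp add: powr_powr)
qed

text \<open>Subtracting a constant makes the value at \<open>0\<close> independent of \<open>\<sigma>\<close>, so that the norm of
  \<open>M(D\<^sup>p\<^sub>\<mu>)\<close> is a supremum of norms of \<open>D\<^sup>p\<^sub>\<mu>\<close>.\<close>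

definition aut_shift :: "(complex \<Rightarrow> complex) \<Rightarrow> (complex \<Rightarrow> complex) \<Rightarrow> complex \<Rightarrow> complex" where
  "aut_shift \<sigma> f = (\<lambda>z. if z \<in> unit_disk then f (\<sigma> z) - f (\<sigma> 0) + f 0 else 0)"

lemma aut_shift_0 [simp]: "aut_shift \<sigma> f 0 = f 0"
  by (simp add: aut_shift_def)

lemma aut_shift_in_disk_analytic:
  assumes "f \<in> disk_analytic" "\<sigma> \<in> disk_aut"
  shows "aut_shift \<sigma> f \<in> disk_analytic"
proof -
  have "(\<lambda>z. (f \<circ> \<sigma>) z - f (\<sigma> 0) + f 0) holomorphic_on unit_disk"
    by (intro holomorphic_intros holomorphic_comp_aut assms)
  then have "aut_shift \<sigma> f holomorphic_on unit_disk"
    by (rule holomorphic_transform) (simp add: aut_shift_def)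
  then show ?thesis
    by (simp add: disk_analytic_def aut_shift_def)
qed

lemma deriv_aut_shift:
  assumes "f \<in> disk_analytic" "\<sigma> \<in> disk_aut" "z \<in> unit_disk"
  shows "deriv (aut_shift \<sigma> f) z = deriv (f \<circ> \<sigma>) z"
proof (rule DERIV_imp_deriv)
  have "((\<lambda>z. (f \<circ> \<sigma>) z - f (\<sigma> 0) + f 0) has_field_derivative deriv (f \<circ> \<sigma>) z) (at z)"
    using DERIV_add[OF DERIV_diff[OF field_differentiable_derivI[OF differentiable_comp_aut[OF assms]]
        DERIV_const[of "f (\<sigma> 0)"]] DERIV_const[of "f 0"]] by simp
  then show "(aut_shift \<sigma> f has_field_derivative deriv (f \<circ> \<sigma>) z) (at z)"
    by (rule has_field_derivative_transform_within_open[of _ _ _ unit_disk])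
       (use assms(3) in \<open>auto simp: aut_shift_def\<close>)
qed

lemma aut_shift_add: "aut_shift \<sigma> (\<lambda>z. f z + g z) = (\<lambda>z. aut_shift \<sigma> f z + aut_shift \<sigma> g z)"
  by (auto simp: aut_shift_def)

lemma aut_shift_scale: "aut_shift \<sigma> (\<lambda>z. c * f z) = (\<lambda>z. c * aut_shift \<sigma> f z)"
  by (auto simp: aut_shift_def algebra_simps)

lemma deriv_comp_aut_add:
  assumes "f \<in> disk_analytic" "g \<in> disk_analytic" "\<sigma> \<in> disk_aut" "z \<in> unit_disk"
  shows "deriv ((\<lambda>x. f x + g x) \<circ> \<sigma>) z = deriv (f \<circ> \<sigma>) z + deriv (g \<circ> \<sigma>) z"
  using deriv_add[OF differentiable_comp_aut[OF assms(1,3,4)] differentiable_comp_aut[OF assms(2,3,4)]]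
  by (simp add: o_def)

lemma deriv_comp_aut_scale:
  assumes "f \<in> disk_analytic" "\<sigma> \<in> disk_aut" "z \<in> unit_disk"
  shows "deriv ((\<lambda>x. c * f x) \<circ> \<sigma>) z = c * deriv (f \<circ> \<sigma>) z"
  using deriv_cmult[OF differentiable_comp_aut[OF assms]] by (simp add: o_def)

text \<open>Symmetry of the norm distance is required for arbitrary functions, so points without a
  derivative count too. There \<open>deriv\<close> chooses from an empty set of candidates, and it
  makes the same choice for \<open>f\<close> and its negative.\<close>

lemma cmod_deriv_minus: "cmod (deriv (\<lambda>x. - f x) z) = cmod (deriv f z)"
proof (cases "f field_differentiable at z")
  case False
  have "(DERIV (\<lambda>x. - f x) z :> D) = (DERIV f z :> D')" for D D'
    using False DERIV_minus[of "\<lambda>x. - f x" D z UNIV] by (auto simp: field_differentiable_def)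
  then have "deriv (\<lambda>x. - f x) z = deriv f z"
    unfolding deriv_def by metis
  then show ?thesis by simp
qed simp

section \<open>Norm structure and functionals of \<open>MDp_space\<close>\<close>

locale dirichlet_type =
  fixes \<mu> :: "complex measure" and p :: real
  assumes p_ge_1: "1 \<le> p"
    and borel: "disk_borel_measure \<mu>"
    and Dp_axiom: "Dp_axiom \<mu> p"
begin

abbreviation "M \<equiv> MDp_space \<mu> p"
abbreviation "MN \<equiv> MDp_norm \<mu> p"

lemma p_pos: "0 < p"
  using p_ge_1 by simp

lemma space_\<mu>: "space \<mu> = unit_disk"
  using sets_eq_imp_space_eq[OF borel[unfolded disk_borel_measure_def]] by (simp add: space_restrict_space)

lemma continuous_borel_measurable_\<mu>:
  fixes f :: "complex \<Rightarrow> 'b :: topological_space"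
  assumes "continuous_on unit_disk f"
  shows "f \<in> borel_measurable \<mu>"
proof -
  have "f \<in> borel_measurable (restrict_space borel unit_disk)"
    by (rule borel_measurable_continuous_on_restrict[OF assms])
  then show ?thesis
    using measurable_cong_sets[OF borel[unfolded disk_borel_measure_def] refl] by blast
qed

lemma deriv_borel_measurable:
  "f holomorphic_on unit_disk \<Longrightarrow> deriv f \<in> borel_measurable \<mu>"
  by (intro continuous_borel_measurable_\<mu> holomorphic_on_imp_continuous_on holomorphic_deriv) auto

lemma deriv_integral_cong:
  "(\<And>z. z \<in> unit_disk \<Longrightarrow> deriv f z = deriv g z) \<Longrightarrow> deriv_integral \<mu> p f = deriv_integral \<mu> p g"
  unfolding deriv_integral_def by (intro nn_integral_cong) (simp add: space_\<mu>)

lemma deriv_integral_aut_shift: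
  "f \<in> disk_analytic \<Longrightarrow> \<sigma> \<in> disk_aut \<Longrightarrow> deriv_integral \<mu> p (aut_shift \<sigma> f) = deriv_integral \<mu> p (f \<circ> \<sigma>)"
  by (intro deriv_integral_cong deriv_aut_shift)

lemma MDp_analytic: "f \<in> M \<Longrightarrow> f \<in> disk_analytic"
  by (simp add: MDp_space_def)

lemma MDp_norm_nonneg: "0 \<le> MN f"
  by (simp add: MDp_norm_def)

lemma MDp_norm_powr: "MN f powr p = cmod (f 0) powr p + enn2real (aut_deriv_integral \<mu> p f)"
  using p_pos by (simp add: MDp_norm_def powr_powr add_nonneg_nonneg)

lemma deriv_integral_le_MDp_norm:
  assumes "f \<in> M" "\<sigma> \<in> disk_aut"
  shows "deriv_integral \<mu> p (f \<circ> \<sigma>) \<le> ennreal (MN f powr p)"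
proof -
  have "deriv_integral \<mu> p (f \<circ> \<sigma>) \<le> aut_deriv_integral \<mu> p f"
    unfolding aut_deriv_integral_def using assms(2) by (rule SUP_upper)
  also have "\<dots> = ennreal (enn2real (aut_deriv_integral \<mu> p f))"
    using assms(1) by (auto simp: MDp_space_def)
  also have "\<dots> \<le> ennreal (MN f powr p)"
    unfolding MDp_norm_powr by (intro ennreal_leI) simp
  finally show ?thesis .
qed

lemma MDp_norm_leI:
  assumes "f \<in> disk_analytic" "0 \<le> c" "0 \<le> t" "cmod (f 0) powr p + t \<le> c powr p"
    and "\<And>\<sigma>. \<sigma> \<in> disk_aut \<Longrightarrow> deriv_integral \<mu> p (f \<circ> \<sigma>) \<le> ennreal t"
  shows "f \<in> M" "MN f \<le> c"
proof -
  have le: "aut_deriv_integral \<mu> p f \<le> ennreal t"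
    unfolding aut_deriv_integral_def using assms(5) by (rule SUP_least)
  then show "f \<in> M"
    using assms(1) by (auto simp: MDp_space_def intro: le_less_trans)
  have "enn2real (aut_deriv_integral \<mu> p f) \<le> t"
    using enn2real_mono[OF le] assms(3) by simp
  then show "MN f \<le> c"
    using assms(2,4) p_pos unfolding MDp_norm_def
    by (subst powr_inverse_le_iff) (auto intro: add_nonneg_nonneg)
qed

text \<open>Since \<open>aut_shift\<close> is linear in \<open>f\<close>, this transfers the
  triangle inequality and homogeneity from the standing axiom on \<open>Dp_space\<close> to the
  supremum over automorphisms.\<close>

lemma MDp_norm_le_iff:
  assumes f: "f \<in> disk_analytic" and c: "0 \<le> c"
  shows "f \<in> M \<and> MN f \<le> c \<longleftrightarrow>
    (\<forall>\<sigma>\<in>disk_aut. aut_shift \<sigma> f \<in> Dp_space \<mu> p \<and> Dp_norm \<mu> p (aut_shift \<sigma> f) \<le> c)"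
    (is "?L \<longleftrightarrow> ?R")
proof
  assume L: ?L
  show ?R
  proof
    fix \<sigma> assume \<sigma>: "\<sigma> \<in> disk_aut"
    have le: "deriv_integral \<mu> p (f \<circ> \<sigma>) \<le> aut_deriv_integral \<mu> p f"
      unfolding aut_deriv_integral_def using \<sigma> by (rule SUP_upper)
    have fin: "aut_deriv_integral \<mu> p f < \<infinity>"
      using L by (simp add: MDp_space_def)
    have "enn2real (deriv_integral \<mu> p (f \<circ> \<sigma>)) \<le> enn2real (aut_deriv_integral \<mu> p f)"
      using le fin by (intro enn2real_mono) auto
    then have "Dp_norm \<mu> p (aut_shift \<sigma> f) \<le> MN f"
      unfolding Dp_norm_def MDp_norm_def using deriv_integral_aut_shift[OF f \<sigma>] p_pos
      by (intro powr_mono2) auto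
    then show "aut_shift \<sigma> f \<in> Dp_space \<mu> p \<and> Dp_norm \<mu> p (aut_shift \<sigma> f) \<le> c"
      using L le_less_trans[OF le fin] deriv_integral_aut_shift[OF f \<sigma>] aut_shift_in_disk_analytic[OF f \<sigma>]
      by (auto simp: Dp_space_def)
  qed
next
  assume R: ?R
  have le: "cmod (f 0) powr p + enn2real (deriv_integral \<mu> p (f \<circ> \<sigma>)) \<le> c powr p"
    and fin: "deriv_integral \<mu> p (f \<circ> \<sigma>) < \<infinity>" if \<sigma>: "\<sigma> \<in> disk_aut" for \<sigma>
    using R \<sigma> c p_pos deriv_integral_aut_shift[OF f \<sigma>]
    by (auto simp: Dp_norm_def Dp_space_def powr_inverse_le_iff add_nonneg_nonneg)
  have "deriv_integral \<mu> p (f \<circ> \<sigma>) \<le> ennreal (c powr p - cmod (f 0) powr p)" if \<sigma>: "\<sigma> \<in> disk_aut" for \<sigma>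
  proof -
    have "deriv_integral \<mu> p (f \<circ> \<sigma>) = ennreal (enn2real (deriv_integral \<mu> p (f \<circ> \<sigma>)))"
      using fin[OF \<sigma>] by simp
    also have "\<dots> \<le> ennreal (c powr p - cmod (f 0) powr p)"
      using le[OF \<sigma>] by (intro ennreal_leI) simp
    finally show ?thesis .
  qed
  moreover have "0 \<le> c powr p - cmod (f 0) powr p"
    using le[OF id_in_disk_aut] enn2real_nonneg[of "deriv_integral \<mu> p (f \<circ> id)"] by linarith
  ultimately show ?L
    using MDp_norm_leI[OF f c, of "c powr p - cmod (f 0) powr p"] by simp
qed

lemma Dp_normed: "normed_fun_space (Dp_space \<mu> p) (Dp_norm \<mu> p)"
  using Dp_axiom by (simp add: Dp_axiom_def banach_fun_space_def)

lemma MDp_shift: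
  assumes "f \<in> M" "\<sigma> \<in> disk_aut"
  shows "aut_shift \<sigma> f \<in> Dp_space \<mu> p" "Dp_norm \<mu> p (aut_shift \<sigma> f) \<le> MN f"
  using MDp_norm_le_iff[OF MDp_analytic[OF assms(1)] MDp_norm_nonneg, of f] assms by auto

lemma MDp_add:
  assumes "f \<in> M" "g \<in> M"
  shows "(\<lambda>z. f z + g z) \<in> M \<and> MN (\<lambda>z. f z + g z) \<le> MN f + MN g"
proof (subst MDp_norm_le_iff)
  show "\<forall>\<sigma>\<in>disk_aut. aut_shift \<sigma> (\<lambda>z. f z + g z) \<in> Dp_space \<mu> p \<and>
      Dp_norm \<mu> p (aut_shift \<sigma> (\<lambda>z. f z + g z)) \<le> MN f + MN g"
  proof
    fix \<sigma> assume \<sigma>: "\<sigma> \<in> disk_aut"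
    show "aut_shift \<sigma> (\<lambda>z. f z + g z) \<in> Dp_space \<mu> p \<and>
        Dp_norm \<mu> p (aut_shift \<sigma> (\<lambda>z. f z + g z)) \<le> MN f + MN g"
      using Dp_normed MDp_shift[OF assms(1) \<sigma>] MDp_shift[OF assms(2) \<sigma>]
      unfolding aut_shift_add normed_fun_space_def by (meson add_mono order_trans)
  qed
qed (use assms MDp_analytic MDp_norm_nonneg disk_analytic_add in \<open>auto intro: add_nonneg_nonneg\<close>)

lemma MDp_scale_le:
  assumes "f \<in> M"
  shows "(\<lambda>z. c * f z) \<in> M \<and> MN (\<lambda>z. c * f z) \<le> cmod c * MN f"
proof (subst MDp_norm_le_iff)
  show "\<forall>\<sigma>\<in>disk_aut. aut_shift \<sigma> (\<lambda>z. c * f z) \<in> Dp_space \<mu> p \<and>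
      Dp_norm \<mu> p (aut_shift \<sigma> (\<lambda>z. c * f z)) \<le> cmod c * MN f"
  proof
    fix \<sigma> assume \<sigma>: "\<sigma> \<in> disk_aut"
    have "aut_shift \<sigma> (\<lambda>z. c * f z) \<in> Dp_space \<mu> p"
        "Dp_norm \<mu> p (aut_shift \<sigma> (\<lambda>z. c * f z)) = cmod c * Dp_norm \<mu> p (aut_shift \<sigma> f)"
      using Dp_normed MDp_shift(1)[OF assms \<sigma>] unfolding aut_shift_scale normed_fun_space_def by blast+
    then show "aut_shift \<sigma> (\<lambda>z. c * f z) \<in> Dp_space \<mu> p \<and>
        Dp_norm \<mu> p (aut_shift \<sigma> (\<lambda>z. c * f z)) \<le> cmod c * MN f"
      using MDp_shift(2)[OF assms \<sigma>] by (simp add: mult_left_mono)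
  qed
qed (use assms MDp_analytic MDp_norm_nonneg disk_analytic_scale in auto)

lemma MDp_zero: "(\<lambda>z. 0) \<in> M" "MN (\<lambda>z. 0) = 0"
proof -
  have *: "deriv_integral \<mu> p ((\<lambda>z. 0) \<circ> \<sigma>) \<le> ennreal 0" for \<sigma>
    using p_pos by (simp add: deriv_integral_def o_def)
  have "(\<lambda>z. 0) \<in> disk_analytic"
    by (simp add: disk_analytic_def)
  from MDp_norm_leI[OF this, of 0 0] * p_pos MDp_norm_nonneg[of "\<lambda>z. 0"]
  show "(\<lambda>z. 0) \<in> M" "MN (\<lambda>z. 0) = 0"
    by auto
qed

lemma MDp_scale:
  assumes "f \<in> M"
  shows "MN (\<lambda>z. c * f z) = cmod c * MN f"
proof (cases "c = 0")
  case True
  then show ?thesis by (simp add: MDp_zero)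
next
  case False
  \<comment> \<open>Undoing the scaling turns the inequality \<open>MDp_scale_le\<close> into its
    converse.\<close>
  have "MN (\<lambda>z. inverse c * (c * f z)) \<le> cmod (inverse c) * MN (\<lambda>z. c * f z)"
    using MDp_scale_le[OF conjunct1[OF MDp_scale_le[OF assms, of c]], of "inverse c"] by simp
  then have "cmod c * MN f \<le> MN (\<lambda>z. c * f z)"
    using False by (simp add: norm_divide field_simps)
  then show ?thesis
    using MDp_scale_le[OF assms, of c] by simp
qed

lemma disk_analytic_aut_shift_id: "f \<in> disk_analytic \<Longrightarrow> aut_shift id f = f"
  by (auto simp: disk_analytic_def aut_shift_def)

lemma MDp_subset_Dp:
  assumes "f \<in> M"
  shows "f \<in> Dp_space \<mu> p" "Dp_norm \<mu> p f \<le> MN f"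
  using MDp_shift[OF assms id_in_disk_aut] disk_analytic_aut_shift_id[OF MDp_analytic[OF assms]] by simp_all

lemma MDp_normed: "normed_fun_space M MN"
proof -
  have "MN f = 0 \<longleftrightarrow> f = (\<lambda>x. 0)" if f: "f \<in> M" for f
  proof
    assume "MN f = 0"
    moreover have "0 \<le> Dp_norm \<mu> p f"
      by (simp add: Dp_norm_def)
    ultimately have "Dp_norm \<mu> p f = 0"
      using MDp_subset_Dp(2)[OF f] by simp
    then show "f = (\<lambda>x. 0)"
      using Dp_normed MDp_subset_Dp(1)[OF f] by (simp add: normed_fun_space_def)
  qed (simp add: MDp_zero)
  then show ?thesis
    using MDp_zero(1) MDp_add MDp_scale_le MDp_scale MDp_norm_nonneg
    by (auto simp: normed_fun_space_def)
qed

lemma MDp_norm_minus: "MN (\<lambda>x. - f x) = MN f"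
proof -
  have "deriv_integral \<mu> p ((\<lambda>x. - f x) \<circ> \<sigma>) = deriv_integral \<mu> p (f \<circ> \<sigma>)" for \<sigma>
    using cmod_deriv_minus[of "f \<circ> \<sigma>"] by (simp add: deriv_integral_def o_def)
  then show ?thesis
    by (simp add: MDp_norm_def aut_deriv_integral_def)
qed

lemma MDp_metric: "Metric_space M (fun_dist MN)"
  by (rule Metric_space_fun_dist[OF MDp_normed MDp_norm_nonneg MDp_norm_minus])

lemma MDp_evaluation: "(\<lambda>f. f z) \<in> fun_dual M MN"
proof -
  have "\<exists>C. \<forall>f\<in>M. cmod (f z) \<le> C * MN f"
  proof (cases "z \<in> unit_disk")
    case True
    then have "compact {z} \<and> {z} \<subseteq> unit_disk" by simp
    then obtain C where C: "\<And>f. f \<in> Dp_space \<mu> p \<Longrightarrow> cmod (f z) \<le> C * Dp_norm \<mu> p f"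
      using Dp_axiom unfolding Dp_axiom_def by (metis singletonI)
    have "cmod (f z) \<le> \<bar>C\<bar> * MN f" if "f \<in> M" for f
    proof -
      have "C * Dp_norm \<mu> p f \<le> \<bar>C\<bar> * MN f"
        using MDp_subset_Dp(2)[OF that] by (intro mult_mono) (auto simp: Dp_norm_def)
      with C[OF MDp_subset_Dp(1)[OF that]] show ?thesis by simp
    qed
    then show ?thesis by blast
  next
    \<comment> \<open>Members of \<open>M\<close> vanish off the disk, so evaluation there is the
      zero functional. Admitting every \<open>z\<close> lets evaluations separate members as total
      functions.\<close>
    case False
    then show ?thesis
      by (intro exI[of _ 0]) (auto simp: MDp_space_def disk_analytic_def)
  qed
  then show ?thesis
    by (simp add: fun_dual_def)
qed

text \<open>The norming functional of \<open>(y \<circ> \<sigma>)'\<close> in \<open>L\<^sup>p\<close>, lifted to \<open>M(D\<^sup>p\<^sub>\<mu>)\<close>. It is bounded because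
  \<open>a * b powr (p - 1) \<le> a powr p + b powr p\<close>.\<close>

definition norming :: "(complex \<Rightarrow> complex) \<Rightarrow> (complex \<Rightarrow> complex) \<Rightarrow> (complex \<Rightarrow> complex) \<Rightarrow> complex" where
  "norming \<sigma> y f = (\<integral>z. deriv (f \<circ> \<sigma>) z * (cnj (sgn (deriv (y \<circ> \<sigma>) z)) *
      complex_of_real (cmod (deriv (y \<circ> \<sigma>) z) powr (p - 1))) \<partial>\<mu>)"

text \<open>A crude Young inequality: the product is at most the p-th power of the larger of
  \<open>a\<close> and \<open>b\<close>. It treats p = 1, where the conjugate exponent is infinite,
  in the same way as p > 1.\<close>

lemma mult_powr_le_sum:
  fixes a b :: real
  assumes "0 \<le> a" "0 \<le> b"
  shows "a * b powr (p - 1) \<le> a powr p + b powr p"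
proof -
  have eq: "x * x powr (p - 1) = x powr p" if "0 \<le> x" for x :: real
    using that powr_mult_base[of x "p - 1"] by simp
  show ?thesis
  proof (cases "a \<le> b")
    case True
    then have "a * b powr (p - 1) \<le> b * b powr (p - 1)"
      by (intro mult_right_mono) auto
    then show ?thesis
      using eq[OF assms(2)] by (smt (verit) powr_ge_zero)
  next
    case False
    then have "a * b powr (p - 1) \<le> a * a powr (p - 1)"
      using assms p_ge_1 by (intro mult_left_mono powr_mono2) auto
    then show ?thesis
      using eq[OF assms(1)] by (smt (verit) powr_ge_zero)
  qed
qed

context
  fixes \<sigma> y
  assumes \<sigma>: "\<sigma> \<in> disk_aut" and y: "y \<in> M"
begin

lemma norming_nn_integral_le:
  assumes f: "f \<in> M"
  shows "(\<integral>\<^sup>+ z. ennreal (cmod (deriv (f \<circ> \<sigma>) z * (cnj (sgn (deriv (y \<circ> \<sigma>) z)) *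
      complex_of_real (cmod (deriv (y \<circ> \<sigma>) z) powr (p - 1))))) \<partial>\<mu>) \<le> ennreal (MN f powr p + MN y powr p)"
    (is "?I \<le> _")
proof -
  have [measurable]: "deriv (f \<circ> \<sigma>) \<in> borel_measurable \<mu>" "deriv (y \<circ> \<sigma>) \<in> borel_measurable \<mu>"
    using f y \<sigma> by (auto intro!: deriv_borel_measurable holomorphic_comp_aut MDp_analytic)
  have "?I \<le> (\<integral>\<^sup>+ z. ennreal (cmod (deriv (f \<circ> \<sigma>) z) powr p) + ennreal (cmod (deriv (y \<circ> \<sigma>) z) powr p) \<partial>\<mu>)"
  proof (rule nn_integral_mono)
    fix z
    let ?a = "cmod (deriv (f \<circ> \<sigma>) z)" and ?b = "cmod (deriv (y \<circ> \<sigma>) z)"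
    have "cmod (deriv (f \<circ> \<sigma>) z * (cnj (sgn (deriv (y \<circ> \<sigma>) z)) * complex_of_real (?b powr (p - 1))))
        \<le> ?a * ?b powr (p - 1)"
      by (simp add: norm_mult norm_sgn)
    also have "\<dots> \<le> ?a powr p + ?b powr p"
      by (rule mult_powr_le_sum) auto
    finally show "ennreal (cmod (deriv (f \<circ> \<sigma>) z * (cnj (sgn (deriv (y \<circ> \<sigma>) z)) *
        complex_of_real (?b powr (p - 1))))) \<le> ennreal (?a powr p) + ennreal (?b powr p)"
      by (simp add: ennreal_plus[symmetric] ennreal_leI del: ennreal_plus)
  qed
  also have "\<dots> = deriv_integral \<mu> p (f \<circ> \<sigma>) + deriv_integral \<mu> p (y \<circ> \<sigma>)"
    unfolding deriv_integral_def by (rule nn_integral_add) auto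
  also have "\<dots> \<le> ennreal (MN f powr p) + ennreal (MN y powr p)"
    by (intro add_mono deriv_integral_le_MDp_norm f y \<sigma>)
  finally show ?thesis by simp
qed

lemma norming_integrable:
  assumes f: "f \<in> M"
  shows "integrable \<mu> (\<lambda>z. deriv (f \<circ> \<sigma>) z * (cnj (sgn (deriv (y \<circ> \<sigma>) z)) *
      complex_of_real (cmod (deriv (y \<circ> \<sigma>) z) powr (p - 1))))"
proof (rule integrableI_bounded)
  have [measurable]: "deriv (f \<circ> \<sigma>) \<in> borel_measurable \<mu>" "deriv (y \<circ> \<sigma>) \<in> borel_measurable \<mu>"
    using f y \<sigma> by (auto intro!: deriv_borel_measurable holomorphic_comp_aut MDp_analytic)
  have [measurable]: "cnj \<in> borel_measurable borel"
    by (intro borel_measurable_continuous_onI continuous_intros)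
  show "(\<lambda>z. deriv (f \<circ> \<sigma>) z * (cnj (sgn (deriv (y \<circ> \<sigma>) z)) *
      complex_of_real (cmod (deriv (y \<circ> \<sigma>) z) powr (p - 1)))) \<in> borel_measurable \<mu>"
    by measurable
qed (rule le_less_trans[OF norming_nn_integral_le[OF f]], simp)

lemma norming_le:
  assumes f: "f \<in> M"
  shows "cmod (norming \<sigma> y f) \<le> MN f powr p + MN y powr p"
proof -
  have "ennreal (cmod (norming \<sigma> y f)) \<le> ennreal (MN f powr p + MN y powr p)"
    unfolding norming_def
    by (rule order_trans[OF integral_norm_bound_ennreal[OF norming_integrable[OF f]] norming_nn_integral_le[OF f]])
  then show ?thesis
    by (subst (asm) ennreal_le_iff) auto
qed

lemma norming_add:
  assumes "f \<in> M" "g \<in> M"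
  shows "norming \<sigma> y (\<lambda>x. f x + g x) = norming \<sigma> y f + norming \<sigma> y g"
proof -
  have "norming \<sigma> y (\<lambda>x. f x + g x) = (\<integral>z. deriv (f \<circ> \<sigma>) z * (cnj (sgn (deriv (y \<circ> \<sigma>) z)) *
      complex_of_real (cmod (deriv (y \<circ> \<sigma>) z) powr (p - 1))) + deriv (g \<circ> \<sigma>) z * (cnj (sgn (deriv (y \<circ> \<sigma>) z)) *
      complex_of_real (cmod (deriv (y \<circ> \<sigma>) z) powr (p - 1))) \<partial>\<mu>)"
    unfolding norming_def
    by (rule Bochner_Integration.integral_cong)
       (use assms \<sigma> in \<open>auto simp: space_\<mu> deriv_comp_aut_add MDp_analytic ring_distribs\<close>)
  also have "\<dots> = norming \<sigma> y f + norming \<sigma> y g"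
    unfolding norming_def by (intro Bochner_Integration.integral_add norming_integrable assms)
  finally show ?thesis .
qed

lemma norming_scale:
  assumes "f \<in> M"
  shows "norming \<sigma> y (\<lambda>x. c * f x) = c * norming \<sigma> y f"
proof -
  have "norming \<sigma> y (\<lambda>x. c * f x) = (\<integral>z. c * (deriv (f \<circ> \<sigma>) z * (cnj (sgn (deriv (y \<circ> \<sigma>) z)) *
      complex_of_real (cmod (deriv (y \<circ> \<sigma>) z) powr (p - 1)))) \<partial>\<mu>)"
    unfolding norming_def
    by (rule Bochner_Integration.integral_cong)
       (use assms \<sigma> in \<open>auto simp: space_\<mu> deriv_comp_aut_scale MDp_analytic\<close>)
  then show ?thesis
    by (simp add: norming_def)
qed

text \<open>The estimate \<open>norming_le\<close> is not homogeneous in \<open>f\<close>. Linearity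
  permits rescaling \<open>f\<close> to norm 1, where the p-th power of the norm is again 1, and
  scaling back gives a linear bound.\<close>

lemma norming_bounded:
  assumes f: "f \<in> M"
  shows "cmod (norming \<sigma> y f) \<le> (1 + MN y powr p) * MN f"
proof (cases "MN f = 0")
  case True
  then have "f = (\<lambda>x. 0)"
    using MDp_normed f by (simp add: normed_fun_space_def)
  then show ?thesis
    using True by (simp add: norming_def o_def)
next
  case False
  define c where "c = complex_of_real (1 / MN f)"
  have c: "cmod c * MN f = 1"
    using False MDp_norm_nonneg[of f] by (simp add: c_def norm_divide)
  have cf: "(\<lambda>x. c * f x) \<in> M" "MN (\<lambda>x. c * f x) = 1"
    using MDp_scale_le[OF f, of c] MDp_scale[OF f, of c] c by auto
  have "cmod c * cmod (norming \<sigma> y f) \<le> 1 + MN y powr p"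
    using norming_le[OF cf(1)] cf(2) by (simp add: norming_scale[OF f] norm_mult)
  then have "(cmod c * cmod (norming \<sigma> y f)) * MN f \<le> (1 + MN y powr p) * MN f"
    using MDp_norm_nonneg by (intro mult_right_mono)
  then show ?thesis
    using c by (simp add: mult_ac) (metis mult.left_commute mult.right_neutral)
qed

lemma norming_in_dual: "norming \<sigma> y \<in> fun_dual M MN"
  using norming_add norming_scale norming_bounded unfolding fun_dual_def by blast

text \<open>At \<open>y\<close> the conjugate sign makes the integrand equal to |(y o sigma)'|^p.
  This is how a small value of a functional is read back as a small integral.\<close>

lemma norming_self: "ennreal (cmod (norming \<sigma> y y)) = deriv_integral \<mu> p (y \<circ> \<sigma>)"
proof -
  have [measurable]: "deriv (y \<circ> \<sigma>) \<in> borel_measurable \<mu>"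
    using y \<sigma> by (auto intro!: deriv_borel_measurable holomorphic_comp_aut MDp_analytic)
  have eq: "a * (cnj (sgn a) * complex_of_real (cmod a powr (p - 1))) = complex_of_real (cmod a powr p)" for a
  proof -
    have "a * cnj (sgn a) = complex_of_real (cmod a)"
      by (simp add: sgn_eq complex_norm_square[symmetric] power2_eq_square)
    moreover have "cmod a * cmod a powr (p - 1) = cmod a powr p"
      using powr_mult_base[of "cmod a" "p - 1"] by simp
    ultimately show ?thesis
      by (metis mult.assoc of_real_mult)
  qed
  have "norming \<sigma> y y = complex_of_real (\<integral>z. cmod (deriv (y \<circ> \<sigma>) z) powr p \<partial>\<mu>)"
    unfolding norming_def eq by simp
  then have "cmod (norming \<sigma> y y) = (\<integral>z. cmod (deriv (y \<circ> \<sigma>) z) powr p \<partial>\<mu>)"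
    by simp
  also have "\<dots> = enn2real (deriv_integral \<mu> p (y \<circ> \<sigma>))"
    unfolding deriv_integral_def by (rule integral_eq_nn_integral) auto
  finally show ?thesis
    using le_less_trans[OF deriv_integral_le_MDp_norm[OF y \<sigma>] ennreal_less_top] by simp
qed

end

end

section \<open>The Bloch space\<close>

lemma bloch_deriv_le:
  assumes "f \<in> bloch_space" "z \<in> unit_disk"
  shows "cmod (f 0) + (1 - (cmod z)\<^sup>2) * cmod (deriv f z) \<le> bloch_norm f"
  using assms cSUP_upper[of z unit_disk "\<lambda>z. (1 - (cmod z)\<^sup>2) * cmod (deriv f z)"]
  by (simp add: bloch_space_def bloch_norm_def)

lemma bloch_normI:
  assumes "f \<in> disk_analytic" "\<And>z. z \<in> unit_disk \<Longrightarrow> cmod (f 0) + (1 - (cmod z)\<^sup>2) * cmod (deriv f z) \<le> c"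
  shows "f \<in> bloch_space" "bloch_norm f \<le> c"
proof -
  have le: "(1 - (cmod z)\<^sup>2) * cmod (deriv f z) \<le> c - cmod (f 0)" if "z \<in> unit_disk" for z
    using assms(2)[OF that] by simp
  then show "f \<in> bloch_space"
    using assms(1) unfolding bloch_space_def by (intro CollectI conjI bdd_aboveI2)
  have "(SUP z\<in>unit_disk. (1 - (cmod z)\<^sup>2) * cmod (deriv f z)) \<le> c - cmod (f 0)"
    using le by (intro cSUP_least) auto
  then show "bloch_norm f \<le> c"
    by (simp add: bloch_norm_def)
qed

lemma one_minus_sq_pos: "z \<in> unit_disk \<Longrightarrow> 0 < 1 - (cmod z)\<^sup>2"
  using power_strict_mono[of "cmod z" 1 2] by simp

lemma bloch_deriv_bound:
  assumes "f \<in> bloch_space" "z \<in> unit_disk"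
  shows "cmod (deriv f z) \<le> bloch_norm f / (1 - (cmod z)\<^sup>2)"
  using bloch_deriv_le[OF assms] one_minus_sq_pos[OF assms(2)] norm_ge_zero[of "f 0"]
  by (simp add: pos_le_divide_eq mult.commute del: norm_ge_zero)

lemma bloch_norm_nonneg: "f \<in> bloch_space \<Longrightarrow> 0 \<le> bloch_norm f"
  using order_trans[OF _ bloch_deriv_le[of f 0], of 0] by simp

lemma bloch_growth:
  assumes f: "f \<in> bloch_space" and r: "0 \<le> r" "r < 1" and z: "cmod z \<le> r"
  shows "cmod (f z) \<le> bloch_norm f * (1 + 1 / (1 - r\<^sup>2))"
proof -
  have sub: "cball 0 r \<subseteq> unit_disk"
    using r by auto
  have r2: "0 < 1 - r\<^sup>2"
    using r power_strict_mono[of r 1 2] by simp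
  have "cmod (f z - f 0) \<le> bloch_norm f / (1 - r\<^sup>2) * cmod (z - 0)"
  proof (rule field_differentiable_bound[of "cball 0 r" f "deriv f"])
    fix w :: complex assume w: "w \<in> cball 0 r"
    then have "w \<in> unit_disk" using sub by blast
    then show "(f has_field_derivative deriv f w) (at w within cball 0 r)"
      using f holomorphic_derivI[of f unit_disk w]
      by (auto simp: bloch_space_def disk_analytic_def intro: has_field_derivative_at_within)
    have "(cmod w)\<^sup>2 \<le> r\<^sup>2"
      using w by (intro power_mono) auto
    then have "bloch_norm f / (1 - (cmod w)\<^sup>2) \<le> bloch_norm f / (1 - r\<^sup>2)"
      using r2 bloch_norm_nonneg[OF f] by (intro divide_left_mono) auto
    then show "cmod (deriv f w) \<le> bloch_norm f / (1 - r\<^sup>2)"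
      using bloch_deriv_bound[OF f \<open>w \<in> unit_disk\<close>] by simp
  qed (use z r in auto)
  also have "\<dots> \<le> bloch_norm f / (1 - r\<^sup>2) * 1"
    using z r r2 bloch_norm_nonneg[OF f] by (intro mult_left_mono) auto
  finally have "cmod (f z - f 0) \<le> bloch_norm f / (1 - r\<^sup>2)"
    by simp
  moreover have "cmod (f 0) \<le> bloch_norm f"
    using bloch_deriv_le[OF f, of 0] norm_ge_zero[of "deriv f 0"] by (simp del: norm_ge_zero)
  ultimately show ?thesis
    using norm_triangle_sub[of "f z" "f 0"] by (simp add: algebra_simps)
qed

section \<open>Locally uniform limits in the Bloch unit ball\<close>

lemma deriv_uniform_limit_subdisk:
  assumes hol: "\<And>n. f n holomorphic_on unit_disk" "g holomorphic_on unit_disk"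
    and lim: "\<And>K. compact K \<Longrightarrow> K \<subseteq> unit_disk \<Longrightarrow> uniform_limit K f g sequentially"
    and r: "0 \<le> r" "r < 1"
  shows "uniform_limit (cball 0 r) (\<lambda>n. deriv (f n)) (deriv g) sequentially"
proof (rule uniform_limitI)
  fix e :: real assume "0 < e"
  \<comment> \<open>Half the distance from the subdisk to the unit circle: Cauchy's inequality on
    discs of this radius stays inside the unit disk. An error below e * d / 2 for the functions
    gives at most e / 2 for the derivatives.\<close>
  define d where "d = (1 - r) / 2"
  have d: "0 < d" "r + d < 1"
    using r by (auto simp: d_def field_simps)
  have "uniform_limit (cball 0 (r + d)) f g sequentially"
    by (rule lim) (use d in auto)
  then have "\<forall>\<^sub>F n in sequentially. \<forall>z\<in>cball 0 (r + d). dist (f n z) (g z) < e * d / 2"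
    using \<open>0 < e\<close> d(1) by (intro uniform_limitD) auto
  then show "\<forall>\<^sub>F n in sequentially. \<forall>z\<in>cball 0 r. dist (deriv (f n) z) (deriv g z) < e"
  proof eventually_elim
    case (elim n)
    show ?case
    proof
      fix z :: complex assume z: "z \<in> cball 0 r"
      have sub: "cball z d \<subseteq> cball 0 (r + d)"
        using z d(1) by (simp add: cball_subset_cball_iff)
      also have "\<dots> \<subseteq> unit_disk"
        using d by auto
      finally have sub': "cball z d \<subseteq> unit_disk" .
      let ?h = "\<lambda>w. f n w - g w"
      have h: "?h holomorphic_on unit_disk"
        by (intro holomorphic_intros hol)
      have "cmod ((deriv ^^ 1) ?h z) \<le> fact 1 * (e * d / 2) / d ^ 1"
      proof (rule Cauchy_inequality)
        show "?h holomorphic_on ball z d"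
          using holomorphic_on_subset[OF h] sub' ball_subset_cball by blast
        show "continuous_on (cball z d) ?h"
          using holomorphic_on_imp_continuous_on[OF h] sub' continuous_on_subset by blast
        fix x assume "cmod (z - x) = d"
        then have "x \<in> cball 0 (r + d)"
          using sub by (auto simp: dist_norm)
        then show "cmod (?h x) \<le> e * d / 2"
          using elim by (force simp: dist_norm)
      qed (use d in auto)
      moreover have "z \<in> unit_disk"
        using z r by auto
      then have "deriv ?h z = deriv (f n) z - deriv g z"
        using deriv_diff[OF holomorphic_on_imp_differentiable_at[OF hol(1) open_ball]
            holomorphic_on_imp_differentiable_at[OF hol(2) open_ball]] by blast
      ultimately show "dist (deriv (f n) z) (deriv g z) < e"
        using \<open>0 < e\<close> d(1) by (simp add: dist_norm)
    qed
  qed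
qed

text \<open>The growth estimate makes the family locally bounded, so Montel's theorem applies. The
  limit stays in the unit ball because the defining inequality at \<open>z\<close> involves only a
  value at 0 and a derivative at \<open>z\<close>, both of which pass to the limit.\<close>

lemma bloch_unit_ball_sequence:
  assumes F: "\<And>n. F n \<in> bloch_space" "\<And>n. bloch_norm (F n) \<le> 1"
  obtains g \<rho> where "strict_mono (\<rho> :: nat \<Rightarrow> nat)" "g \<in> bloch_space" "bloch_norm g \<le> 1"
    "\<And>z. (\<lambda>n. F (\<rho> n) z) \<longlonglongrightarrow> g z"
    "\<And>r. 0 \<le> r \<Longrightarrow> r < 1 \<Longrightarrow> uniform_limit (cball 0 r) (\<lambda>n. deriv (F (\<rho> n))) (deriv g) sequentially"
proof -
  have holF: "F n holomorphic_on unit_disk" for n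
    using F(1) by (simp add: bloch_space_def disk_analytic_def)
  have bdd: "\<exists>B. \<forall>h\<in>range F. \<forall>z\<in>K. cmod (h z) \<le> B" if K: "compact K" "K \<subseteq> unit_disk" for K
  proof (cases "K = {}")
    case False
    obtain w where w: "w \<in> K" "\<And>z. z \<in> K \<Longrightarrow> cmod z \<le> cmod w"
      using continuous_attains_sup[OF K(1) False, of cmod] by (auto intro: continuous_intros)
    have w1: "cmod w < 1"
      using w(1) K(2) by auto
    then have w2: "0 < 1 - (cmod w)\<^sup>2"
      by (intro one_minus_sq_pos) auto
    have "cmod (F n z) \<le> 1 * (1 + 1 / (1 - (cmod w)\<^sup>2))" if "z \<in> K" for n z
      by (rule order_trans[OF bloch_growth[OF F(1) norm_ge_zero w1 w(2)[OF that]]])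
         (use F(2)[of n] w2 in \<open>intro mult_right_mono; simp\<close>)
    then show ?thesis by blast
  qed auto
  obtain g0 \<rho> where g0: "g0 holomorphic_on unit_disk" and \<rho>: "strict_mono (\<rho> :: nat \<Rightarrow> nat)"
    and pt: "\<And>x. x \<in> unit_disk \<Longrightarrow> (\<lambda>n. F (\<rho> n) x) \<longlonglongrightarrow> g0 x"
    and unif: "\<And>K. compact K \<Longrightarrow> K \<subseteq> unit_disk \<Longrightarrow> uniform_limit K (F \<circ> \<rho>) g0 sequentially"
  proof (rule Montel[OF open_ball, of "range F" 0 1 F])
    show "h holomorphic_on unit_disk" if "h \<in> range F" for h
      using that holF by blast
  qed (use bdd in auto)
  define g where "g z = (if z \<in> unit_disk then g0 z else 0)" for z
  have g_hol: "g holomorphic_on unit_disk"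
    using g0 by (rule holomorphic_transform) (simp add: g_def)
  have g_an: "g \<in> disk_analytic"
    using g_hol by (simp add: disk_analytic_def g_def)
  have ptg: "(\<lambda>n. F (\<rho> n) z) \<longlonglongrightarrow> g z" for z
    using pt[of z] F(1) by (cases "z \<in> unit_disk") (auto simp: g_def bloch_space_def disk_analytic_def)
  have unifg: "uniform_limit K (F \<circ> \<rho>) g sequentially" if "compact K" "K \<subseteq> unit_disk" for K
    using unif[OF that] that(2) by (subst uniform_limit_cong'[where g = "F \<circ> \<rho>" and i = g0]) (auto simp: g_def)
  have dunif: "uniform_limit (cball 0 r) (\<lambda>n. deriv (F (\<rho> n))) (deriv g) sequentially"
    if "0 \<le> r" "r < 1" for r
    using deriv_uniform_limit_subdisk[of "F \<circ> \<rho>" g r] holF g_hol unifg that by simp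
  have "cmod (g 0) + (1 - (cmod z)\<^sup>2) * cmod (deriv g z) \<le> 1" if z: "z \<in> unit_disk" for z
  proof (rule Lim_bounded)
    have "(\<lambda>n. deriv (F (\<rho> n)) z) \<longlonglongrightarrow> deriv g z"
      using z by (intro tendsto_uniform_limitI[OF dunif[of "cmod z"]]) auto
    then show "(\<lambda>n. cmod (F (\<rho> n) 0) + (1 - (cmod z)\<^sup>2) * cmod (deriv (F (\<rho> n)) z))
        \<longlonglongrightarrow> cmod (g 0) + (1 - (cmod z)\<^sup>2) * cmod (deriv g z)"
      by (intro tendsto_intros ptg)
    show "\<forall>n\<ge>0. cmod (F (\<rho> n) 0) + (1 - (cmod z)\<^sup>2) * cmod (deriv (F (\<rho> n)) z) \<le> 1"
      using bloch_deriv_le[OF F(1) z] F(2) order_trans by blast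
  qed
  with that[OF \<rho> bloch_normI[OF g_an] ptg dunif] show thesis
    by blast
qed

lemma id_in_bloch_space: "(\<lambda>z. if z \<in> unit_disk then z else 0) \<in> bloch_space"
proof (rule bloch_normI)
  let ?f = "\<lambda>z :: complex. if z \<in> unit_disk then z else 0"
  have "(\<lambda>z. z) holomorphic_on unit_disk"
    by (intro holomorphic_intros)
  then have "?f holomorphic_on unit_disk"
    by (rule holomorphic_transform) auto
  then show "?f \<in> disk_analytic"
    by (simp add: disk_analytic_def)
  fix z :: complex assume z: "z \<in> unit_disk"
  have "deriv ?f z = 1"
    by (rule DERIV_imp_deriv, rule has_field_derivative_transform_within_open[OF DERIV_ident open_ball z]) auto
  then show "cmod (?f 0) + (1 - (cmod z)\<^sup>2) * cmod (deriv ?f z) \<le> 1"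
    by simp
qed

section \<open>Lacunary series\<close>

definition lacunary :: "(nat \<Rightarrow> complex) \<Rightarrow> complex \<Rightarrow> complex" where
  "lacunary c z = (if z \<in> unit_disk then \<Sum>n. c n * z ^ (2 ^ n) else 0)"

lemma lacunary_term_le:
  assumes "cmod (c n) \<le> B" "cmod z \<le> r" "r \<le> 1"
  shows "cmod (c n * z ^ (2 ^ n)) \<le> B * r ^ n"
proof -
  have "0 \<le> r"
    using assms(2) norm_ge_zero order_trans by blast
  have "cmod z ^ (2 ^ n) \<le> r ^ (2 ^ n)"
    using assms(2) by (intro power_mono) auto
  also have "\<dots> \<le> r ^ n"
    using assms(3) \<open>0 \<le> r\<close> by (intro power_decreasing) (auto intro: less_imp_le)
  finally show ?thesis
    using assms(1) order_trans[OF norm_ge_zero assms(1)] unfolding norm_mult norm_power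
    by (intro mult_mono) auto
qed

lemma lacunary_summable:
  assumes "\<And>n. cmod (c n) \<le> B" "z \<in> unit_disk"
  shows "summable (\<lambda>n. c n * z ^ (2 ^ n))"
proof (rule summable_comparison_test)
  show "\<exists>N. \<forall>n\<ge>N. cmod (c n * z ^ (2 ^ n)) \<le> B * cmod z ^ n"
    using lacunary_term_le[of c _ B z "cmod z"] assms by auto
  show "summable (\<lambda>n. B * cmod z ^ n)"
    using assms(2) by (intro summable_mult summable_geometric) auto
qed

lemma lacunary_add:
  assumes "\<And>n. cmod (c n) \<le> B" "\<And>n. cmod (d n) \<le> B'"
  shows "lacunary (\<lambda>n. c n + d n) = (\<lambda>z. lacunary c z + lacunary d z)"
  using suminf_add[OF lacunary_summable[OF assms(1)] lacunary_summable[OF assms(2)]]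
  by (auto simp: lacunary_def ring_distribs)

lemma lacunary_scale:
  assumes "\<And>n. cmod (c n) \<le> B"
  shows "lacunary (\<lambda>n. a * c n) = (\<lambda>z. a * lacunary c z)"
  using suminf_mult[OF lacunary_summable[OF assms], of _ a] by (auto simp: lacunary_def mult.assoc)

lemma lacunary_finite:
  assumes "finite F" "\<And>n. n \<notin> F \<Longrightarrow> c n = 0" "z \<in> unit_disk"
  shows "lacunary c z = (\<Sum>n\<in>F. c n * z ^ (2 ^ n))"
  using assms by (simp add: lacunary_def suminf_finite)

lemma lacunary_finite_deriv:
  assumes "finite F" "\<And>n. n \<notin> F \<Longrightarrow> c n = 0" "z \<in> unit_disk"
  shows "deriv (lacunary c) z = (\<Sum>n\<in>F. c n * (2 ^ n * z ^ (2 ^ n - 1)))"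
proof (rule DERIV_imp_deriv)
  have "((\<lambda>z. \<Sum>n\<in>F. c n * z ^ (2 ^ n)) has_field_derivative (\<Sum>n\<in>F. c n * (2 ^ n * z ^ (2 ^ n - 1)))) (at z)"
    by (auto intro!: derivative_eq_intros sum.cong)
  then show "(lacunary c has_field_derivative (\<Sum>n\<in>F. c n * (2 ^ n * z ^ (2 ^ n - 1)))) (at z)"
    by (rule has_field_derivative_transform_within_open[OF _ open_ball assms(3)])
       (rule lacunary_finite[OF assms(1,2), symmetric])
qed

text \<open>Tannery's theorem with the majorant B * |z|^k. It supplies the pointwise convergence of
  truncations that the l^infinity lemma asks for.\<close>

lemma lacunary_tendsto:
  assumes "\<And>m k. cmod (c m k) \<le> B" "\<And>k. (\<lambda>m. c m k) \<longlonglongrightarrow> d k"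
  shows "(\<lambda>m. lacunary (c m) z) \<longlonglongrightarrow> lacunary d z"
proof (cases "z \<in> unit_disk")
  case True
  have "(\<lambda>m. \<Sum>k. c m k * z ^ (2 ^ k)) \<longlonglongrightarrow> (\<Sum>k. d k * z ^ (2 ^ k))"
  proof (intro tannerys_theorem[THEN conjunct2, THEN conjunct2])
    show "\<forall>\<^sub>F (k, m) in sequentially \<times>\<^sub>F sequentially. cmod (c m k * z ^ (2 ^ k)) \<le> B * cmod z ^ k"
      using lacunary_term_le[OF assms(1), of z "cmod z"] True by (intro always_eventually) auto
    show "summable (\<lambda>k. B * cmod z ^ k)"
      using True by (intro summable_mult summable_geometric) auto
  qed (use assms(2) in \<open>auto intro: tendsto_intros\<close>)
  with True show ?thesis
    by (simp add: lacunary_def)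
qed (simp add: lacunary_def)

lemma lacunary_uniform_limit:
  assumes "\<And>n. cmod (c n) \<le> B" "r < 1"
  shows "uniform_limit (cball 0 r) (\<lambda>N z. \<Sum>n<N. c n * z ^ (2 ^ n)) (lacunary c) sequentially"
proof -
  have "uniform_limit (cball 0 r) (\<lambda>N z. \<Sum>n<N. c n * z ^ (2 ^ n)) (\<lambda>z. \<Sum>n. c n * z ^ (2 ^ n)) sequentially"
  proof (cases "0 \<le> r")
    case True
    show ?thesis
      by (rule Weierstrass_m_test[of _ _ "\<lambda>n. B * r ^ n"])
         (use True assms lacunary_term_le[of c _ B _ r] in \<open>auto intro: summable_mult summable_geometric\<close>)
  qed (simp add: uniform_limit_iff)
  then show ?thesis
    using assms(2) by (subst uniform_limit_cong'[where i = "\<lambda>z. \<Sum>n. c n * z ^ (2 ^ n)" and g = "\<lambda>N z. \<Sum>n<N. c n * z ^ (2 ^ n)"])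
      (auto simp: lacunary_def)
qed

lemma lacunary_holomorphic:
  assumes "\<And>n. cmod (c n) \<le> B"
  shows "lacunary c holomorphic_on unit_disk"
proof (rule holomorphic_uniform_sequence)
  fix z :: complex assume z: "z \<in> unit_disk"
  define d where "d = (1 - cmod z) / 2"
  have d: "0 < d" "cmod z + d < 1"
    using z by (auto simp: d_def field_simps)
  have sub: "cball z d \<subseteq> cball 0 (cmod z + d)"
    using d(1) by (simp add: cball_subset_cball_iff)
  moreover have "cball 0 (cmod z + d) \<subseteq> unit_disk"
    using d by auto
  ultimately show "\<exists>d>0. cball z d \<subseteq> unit_disk \<and>
      uniform_limit (cball z d) (\<lambda>N z. \<Sum>n<N. c n * z ^ (2 ^ n)) (lacunary c) sequentially"
    using d(1) by (intro exI[of _ d] conjI uniform_limit_on_subset[OF lacunary_uniform_limit[OF assms d(2)] sub])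
      (assumption, rule subset_trans)
qed (auto intro!: holomorphic_intros)

text \<open>The dyadic block from 2^n to 2^(n+1) - 1 has 2^n exponents, and each of its powers is at
  least its last one. So each term after the first is at most twice a block of the geometric series,
  and the total is at most 1 + 2 / (1 - x).\<close>

lemma sum_lacunary_deriv_le:
  fixes x :: real
  assumes "0 \<le> x" "x < 1"
  shows "(\<Sum>n<N. 2 ^ n * x ^ (2 ^ n - 1)) \<le> 3 / (1 - x)"
proof -
  have *: "(\<Sum>n<Suc N. 2 ^ n * x ^ (2 ^ n - 1)) \<le> 1 + 2 * (\<Sum>m<(2::nat) ^ N. x ^ m)" for N
  proof (induction N)
    case (Suc N)
    have "2 ^ N * x ^ (2 ^ Suc N - 1) = (\<Sum>m\<in>{(2::nat) ^ N..<2 ^ Suc N}. x ^ (2 ^ Suc N - 1))"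
      by simp
    also have "\<dots> \<le> (\<Sum>m\<in>{(2::nat) ^ N..<2 ^ Suc N}. x ^ m)"
      using assms by (intro sum_mono power_decreasing) auto
    finally have "2 ^ Suc N * x ^ (2 ^ Suc N - 1) \<le> 2 * (\<Sum>m\<in>{(2::nat) ^ N..<2 ^ Suc N}. x ^ m)"
      by simp
    moreover have "(\<Sum>m<(2::nat) ^ Suc N. x ^ m) = (\<Sum>m<(2::nat) ^ N. x ^ m) + (\<Sum>m\<in>{(2::nat) ^ N..<2 ^ Suc N}. x ^ m)"
      by (simp add: lessThan_atLeast0 sum.atLeastLessThan_concat)
    ultimately show ?case
      using Suc.IH by simp
  qed simp
  have "(\<Sum>n<N. 2 ^ n * x ^ (2 ^ n - 1)) \<le> (\<Sum>n<Suc N. 2 ^ n * x ^ (2 ^ n - 1))"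
    using assms by simp
  also have "\<dots> \<le> 1 + 2 * (\<Sum>m<(2::nat) ^ N. x ^ m)"
    by (rule *)
  also have "(\<Sum>m<(2::nat) ^ N. x ^ m) = (1 - x ^ 2 ^ N) / (1 - x)"
    using assms by (simp add: sum_gp_strict)
  also have "\<dots> \<le> 1 / (1 - x)"
    using assms by (intro divide_right_mono) auto
  finally have "(\<Sum>n<N. 2 ^ n * x ^ (2 ^ n - 1)) \<le> 1 + 2 * (1 / (1 - x))"
    by simp
  moreover have "1 \<le> 1 / (1 - x)"
    using assms by simp
  ultimately show ?thesis by simp
qed

lemma lacunary_deriv_le:
  assumes c: "\<And>n. cmod (c n) \<le> B" and z: "z \<in> unit_disk"
  shows "cmod (deriv (lacunary c) z) \<le> B * (3 / (1 - cmod z))"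
proof (rule Lim_bounded)
  have B: "0 \<le> B"
    using c[of 0] norm_ge_zero order_trans by blast
  define r where "r = (1 + cmod z) / 2"
  have r: "cmod z < r" "r < 1"
    using z by (auto simp: r_def field_simps)
  have "(\<lambda>N. deriv (\<lambda>z. \<Sum>n<N. c n * z ^ (2 ^ n)) z) \<longlonglongrightarrow> deriv (lacunary c) z"
  proof (rule deriv_complex_uniform_limit[where A = "ball 0 r"])
    show "uniform_limit (ball 0 r) (\<lambda>N z. \<Sum>n<N. c n * z ^ (2 ^ n)) (lacunary c) sequentially"
      by (rule uniform_limit_on_subset[OF lacunary_uniform_limit[OF c r(2)] ball_subset_cball])
  qed (use r in \<open>auto intro!: always_eventually holomorphic_intros\<close>)
  then show "(\<lambda>N. cmod (deriv (\<lambda>z. \<Sum>n<N. c n * z ^ (2 ^ n)) z)) \<longlonglongrightarrow> cmod (deriv (lacunary c) z)"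
    by (rule tendsto_norm)
  show "\<forall>N\<ge>0. cmod (deriv (\<lambda>z. \<Sum>n<N. c n * z ^ (2 ^ n)) z) \<le> B * (3 / (1 - cmod z))"
  proof (intro allI impI)
    fix N
    have "((\<lambda>z. \<Sum>n<N. c n * z ^ (2 ^ n)) has_field_derivative (\<Sum>n<N. c n * (2 ^ n * z ^ (2 ^ n - 1)))) (at z)"
      by (auto intro!: derivative_eq_intros sum.cong)
    then have "cmod (deriv (\<lambda>z. \<Sum>n<N. c n * z ^ (2 ^ n)) z) \<le> (\<Sum>n<N. cmod (c n * (2 ^ n * z ^ (2 ^ n - 1))))"
      by (simp add: DERIV_imp_deriv norm_sum)
    also have "\<dots> \<le> (\<Sum>n<N. B * (2 ^ n * cmod z ^ (2 ^ n - 1)))"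
      using c by (intro sum_mono) (simp add: norm_mult norm_power mult_right_mono)
    also have "\<dots> = B * (\<Sum>n<N. 2 ^ n * cmod z ^ (2 ^ n - 1))"
      by (simp add: sum_distrib_left)
    also have "\<dots> \<le> B * (3 / (1 - cmod z))"
      using z B by (intro mult_left_mono sum_lacunary_deriv_le) auto
    finally show "cmod (deriv (\<lambda>z. \<Sum>n<N. c n * z ^ (2 ^ n)) z) \<le> B * (3 / (1 - cmod z))" .
  qed
qed

text \<open>The constant is 2 * 3: the factor 2 comes from 1 - |z|^2 <= 2 * (1 - |z|) and the 3 from
  the derivative bound. All exponents are positive, so the value at 0 contributes nothing.\<close>

lemma lacunary_bloch:
  assumes c: "\<And>n. cmod (c n) \<le> B"
  shows "lacunary c \<in> bloch_space" "bloch_norm (lacunary c) \<le> 6 * B"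
proof -
  have B: "0 \<le> B"
    using c[of 0] norm_ge_zero order_trans by blast
  have an: "lacunary c \<in> disk_analytic"
    using lacunary_holomorphic[OF c] by (simp add: disk_analytic_def lacunary_def)
  have "cmod (lacunary c 0) + (1 - (cmod z)\<^sup>2) * cmod (deriv (lacunary c) z) \<le> 6 * B" if z: "z \<in> unit_disk" for z
  proof -
    have "(1 - (cmod z)\<^sup>2) * cmod (deriv (lacunary c) z) \<le> (2 * (1 - cmod z)) * (B * (3 / (1 - cmod z)))"
    proof (rule mult_mono[OF _ lacunary_deriv_le[OF c z]])
      have "0 \<le> (1 - cmod z)\<^sup>2" by simp
      then show "1 - (cmod z)\<^sup>2 \<le> 2 * (1 - cmod z)"
        by (simp add: power2_eq_square algebra_simps)
    qed (use z in auto)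
    also have "\<dots> = 6 * B"
      using z by (simp add: field_simps)
    finally have "(1 - (cmod z)\<^sup>2) * cmod (deriv (lacunary c) z) \<le> 6 * B" .
    moreover have "lacunary c 0 = 0"
      by (simp add: lacunary_def power_0_left)
    ultimately show ?thesis
      by simp
  qed
  from bloch_normI[OF an this] show "lacunary c \<in> bloch_space" "bloch_norm (lacunary c) \<le> 6 * B"
    by auto
qed

text \<open>The exponent \<open>2 ^ k\<close> is chosen comparable to \<open>1 / (2 * (1 - x))\<close>, and Bernoulli's inequality bounds
  \<open>x ^ 2 ^ k\<close> from below.\<close>

lemma lacunary_term_lower_bound:
  fixes x :: real
  assumes "1 - 1 / 2 ^ Suc N \<le> x" "x < 1"
  obtains k where "N \<le> k" "1 / (8 * (1 - x\<^sup>2)) \<le> 2 ^ k * x ^ (2 ^ k - 1)"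
proof -
  define t where "t = 1 - x"
  have t: "0 < t" "t * 2 ^ Suc N \<le> 1"
    using assms by (auto simp: t_def field_simps)
  have "(2::real) ^ Suc N \<ge> 2"
    using power_increasing[of 1 "Suc N" "2::real"] by simp
  then have "t * 2 \<le> 1"
    using t mult_left_mono[of 2 "2 ^ Suc N" t] by linarith
  then have x0: "0 < x" by (simp add: t_def)
  \<comment> \<open>By this choice 2^k exceeds 1 / (4 * t); together with x^(2^k - 1) >= 1/2 this
    produces the 8 in the conclusion.\<close>
  define k where "k = (LEAST n. 1 / t < 2 ^ (n + 2))"
  obtain n where "1 / t < 2 ^ n"
    using real_arch_pow[of 2 "1 / t"] by auto
  then have "1 / t < 2 ^ (n + 2)"
    by (rule less_le_trans) (intro power_increasing, auto)
  then have k: "1 / t < 2 ^ (k + 2)"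
    unfolding k_def by (rule LeastI)
  have Nk: "N \<le> k"
  proof (rule ccontr)
    assume "\<not> N \<le> k"
    then have "(2::real) ^ (k + 2) \<le> 2 ^ Suc N"
      by (intro power_increasing) auto
    moreover have "2 ^ Suc N \<le> 1 / t"
      using t by (simp add: pos_le_divide_eq mult.commute)
    ultimately show False
      using k by linarith
  qed
  \<comment> \<open>For \<open>k\<close> above \<open>N\<close> minimality is applied to the
    predecessor of \<open>k\<close>. For \<open>k = N\<close>, which may be 0, the distance of
    \<open>x\<close> from 1 gives the bound directly.\<close>
  have le: "2 ^ k * t \<le> 1 / 2"
  proof (cases "k = N")
    case True
    then show ?thesis using t(2) by (simp add: mult.commute)
  next
    case False
    then obtain j where j: "k = Suc j"
      using Nk by (cases k) auto
    then have "\<not> 1 / t < 2 ^ (j + 2)"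
      unfolding k_def by (metis lessI not_less_Least)
    then show ?thesis
      using t j by (simp add: field_simps)
  qed
  have "1 / 2 \<le> 1 + real (2 ^ k) * (- t)"
    using le by simp
  also have "\<dots> \<le> (1 + (- t)) ^ 2 ^ k"
    using x0 by (intro Bernoulli_inequality) (simp add: t_def)
  also have "\<dots> = x ^ 2 ^ k"
    by (simp add: t_def)
  also have "\<dots> \<le> x ^ (2 ^ k - 1)"
    using x0 assms by (intro power_decreasing) auto
  finally have half: "1 / 2 \<le> x ^ (2 ^ k - 1)" .
  have "t \<le> 1 - x\<^sup>2"
    using x0 assms by (simp add: t_def power2_eq_square mult_left_le_one_le)
  then have "1 / (8 * (1 - x\<^sup>2)) \<le> 1 / (8 * t)"
    using t by (intro divide_left_mono) auto
  also have "\<dots> = (1 / t) / 8"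
    by simp
  also have "\<dots> \<le> 2 ^ k * (1 / 2)"
    using k by simp
  also have "\<dots> \<le> 2 ^ k * x ^ (2 ^ k - 1)"
    using half by (intro mult_left_mono) auto
  finally show thesis
    using that[OF Nk] by blast
qed

text \<open>Flipping every sign except that of \<open>j\<close> is an involution of the sign patterns (coded as subsets of
  \<open>F\<close>), and the sum of \<open>S P\<close> and its flip is \<open>\<plusminus> 2 * a j\<close>.\<close>

lemma sign_average:
  fixes a :: "nat \<Rightarrow> complex"
  assumes F: "finite F" "j \<in> F" and p: "1 \<le> p"
  shows "2 ^ card F * cmod (a j) powr p \<le> 2 * (\<Sum>P\<in>Pow F. cmod (\<Sum>k\<in>F. (if k \<in> P then 1 else - 1) * a k) powr p)"
proof -
  define S where "S P = (\<Sum>k\<in>F. (if k \<in> P then 1 else - 1) * a k)" for P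
  define flip where "flip P = {k \<in> F. (k \<in> P) \<longleftrightarrow> k = j}" for P
  have bij: "bij_betw flip (Pow F) (Pow F)"
    by (rule bij_betw_byWitness[where f' = flip]) (auto simp: flip_def)
  have le: "cmod (a j) powr p \<le> cmod (S P) powr p + cmod (S (flip P)) powr p" if "P \<in> Pow F" for P
  proof -
    have "S P + S (flip P) = (\<Sum>k\<in>F. if k = j then 2 * ((if j \<in> P then 1 else - 1) * a j) else 0)"
      unfolding S_def sum.distrib[symmetric] by (rule sum.cong) (auto simp: flip_def)
    also have "\<dots> = 2 * ((if j \<in> P then 1 else - 1) * a j)"
      using F by simp
    finally have "2 * cmod (a j) = cmod (S P + S (flip P))"
      by (simp add: norm_mult)
    also have "\<dots> \<le> cmod (S P) + cmod (S (flip P))"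
      by (rule norm_triangle_ineq)
    finally have "cmod (a j) \<le> max (cmod (S P)) (cmod (S (flip P)))"
      by simp
    then have "cmod (a j) powr p \<le> max (cmod (S P)) (cmod (S (flip P))) powr p"
      using p by (intro powr_mono2) auto
    also have "\<dots> \<le> cmod (S P) powr p + cmod (S (flip P)) powr p"
      by (simp add: max_def)
    finally show ?thesis .
  qed
  have "2 ^ card F * cmod (a j) powr p = (\<Sum>P\<in>Pow F. cmod (a j) powr p)"
    using F(1) by (simp add: card_Pow)
  also have "\<dots> \<le> (\<Sum>P\<in>Pow F. cmod (S P) powr p + cmod (S (flip P)) powr p)"
    by (rule sum_mono[OF le])
  also have "\<dots> = 2 * (\<Sum>P\<in>Pow F. cmod (S P) powr p)"
    using sum.reindex_bij_betw[OF bij, of "\<lambda>P. cmod (S P) powr p"] by (simp add: sum.distrib)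
  finally show ?thesis
    by (simp add: S_def)
qed

section \<open>Composition operators\<close>

locale bloch_composition = dirichlet_type +
  fixes \<phi> :: "complex \<Rightarrow> complex"
  assumes self_map: "disk_self_map \<phi>"
    and bounded: "bounded_operator bloch_space bloch_norm (MDp_space \<mu> p) (MDp_norm \<mu> p) (comp_op \<phi>)"
begin

abbreviation "T \<equiv> comp_op \<phi>"

definition tail :: "real \<Rightarrow> ennreal" where
  "tail r = (SUP \<sigma>\<in>disk_aut. \<integral>\<^sup>+ z \<in> {z \<in> unit_disk. cmod ((\<phi> \<circ> \<sigma>) z) > r}.
     ennreal (hyp_deriv (\<phi> \<circ> \<sigma>) z powr p) \<partial>\<mu>)"

lemma phi_in: "z \<in> unit_disk \<Longrightarrow> \<phi> z \<in> unit_disk"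
  using self_map unfolding disk_self_map_def by blast

lemma phi_aut_holomorphic: "\<sigma> \<in> disk_aut \<Longrightarrow> (\<phi> \<circ> \<sigma>) holomorphic_on unit_disk"
  by (rule holomorphic_on_compose_gen[of _ _ _ unit_disk])
     (use disk_autD self_map in \<open>auto simp: disk_self_map_def\<close>)

lemma phi_aut_in: "\<sigma> \<in> disk_aut \<Longrightarrow> z \<in> unit_disk \<Longrightarrow> \<phi> (\<sigma> z) \<in> unit_disk"
  using disk_autD(2) phi_in by blast

lemma T_analytic:
  assumes "f \<in> disk_analytic"
  shows "T f \<in> disk_analytic"
proof -
  have "(f \<circ> \<phi>) holomorphic_on unit_disk"
    by (rule holomorphic_on_compose_gen[of _ _ _ unit_disk])
       (use assms self_map in \<open>auto simp: disk_self_map_def disk_analytic_def\<close>)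
  then have "T f holomorphic_on unit_disk"
    by (rule holomorphic_transform) (simp add: comp_op_def)
  then show ?thesis
    by (simp add: disk_analytic_def comp_op_def)
qed

lemma deriv_T_aut:
  assumes f: "f \<in> disk_analytic" and \<sigma>: "\<sigma> \<in> disk_aut" and z: "z \<in> unit_disk"
  shows "deriv (T f \<circ> \<sigma>) z = deriv f (\<phi> (\<sigma> z)) * deriv (\<phi> \<circ> \<sigma>) z"
proof (rule DERIV_imp_deriv)
  have "((\<phi> \<circ> \<sigma>) has_field_derivative deriv (\<phi> \<circ> \<sigma>) z) (at z)"
    by (rule holomorphic_derivI[OF phi_aut_holomorphic[OF \<sigma>] open_ball z])
  moreover have "(f has_field_derivative deriv f (\<phi> (\<sigma> z))) (at ((\<phi> \<circ> \<sigma>) z))"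
    using holomorphic_derivI[OF disk_analytic_holomorphic[OF f] open_ball phi_aut_in[OF \<sigma> z]] by simp
  ultimately have "((f \<circ> (\<phi> \<circ> \<sigma>)) has_field_derivative deriv f (\<phi> (\<sigma> z)) * deriv (\<phi> \<circ> \<sigma>) z) (at z)"
    by (rule DERIV_chain[rotated])
  then show "((T f \<circ> \<sigma>) has_field_derivative deriv f (\<phi> (\<sigma> z)) * deriv (\<phi> \<circ> \<sigma>) z) (at z)"
    by (rule has_field_derivative_transform_within_open[OF _ open_ball z])
       (use disk_autD(2)[OF \<sigma>] in \<open>simp add: comp_op_def\<close>)
qed

lemma borel_measurable_phi_aut [measurable]: "\<sigma> \<in> disk_aut \<Longrightarrow> \<phi> \<circ> \<sigma> \<in> borel_measurable \<mu>"
  by (intro continuous_borel_measurable_\<mu> holomorphic_on_imp_continuous_on phi_aut_holomorphic)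

lemma borel_measurable_deriv_phi_aut [measurable]: "\<sigma> \<in> disk_aut \<Longrightarrow> deriv (\<phi> \<circ> \<sigma>) \<in> borel_measurable \<mu>"
  by (intro deriv_borel_measurable phi_aut_holomorphic)

lemma borel_measurable_hyp_deriv [measurable]:
  "\<sigma> \<in> disk_aut \<Longrightarrow> hyp_deriv (\<phi> \<circ> \<sigma>) \<in> borel_measurable \<mu>"
  unfolding hyp_deriv_def[abs_def] by measurable

lemma tail_set [measurable]:
  assumes "\<sigma> \<in> disk_aut"
  shows "{z \<in> unit_disk. cmod ((\<phi> \<circ> \<sigma>) z) > r} \<in> sets \<mu>"
proof -
  have "{z \<in> space \<mu>. cmod ((\<phi> \<circ> \<sigma>) z) > r} \<in> sets \<mu>"
    using borel_measurable_phi_aut[OF assms] by measurable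
  then show ?thesis
    by (simp add: space_\<mu>)
qed

text \<open>Members of \<open>M\<close> vanish off the disk, whereas \<open>\<phi>\<close> is
  arbitrary there. This is the representative of \<open>\<phi>\<close> by a member of
  \<open>M\<close>.\<close>

definition phi_ext :: "complex \<Rightarrow> complex" where
  "phi_ext = T (\<lambda>z. if z \<in> unit_disk then z else 0)"

lemma phi_ext_MDp: "phi_ext \<in> M"
  using bounded id_in_bloch_space unfolding phi_ext_def bounded_operator_def by blast

lemma phi_integral_le:
  assumes "\<sigma> \<in> disk_aut"
  shows "deriv_integral \<mu> p (\<phi> \<circ> \<sigma>) \<le> ennreal (MN phi_ext powr p)"
proof -
  have "deriv (phi_ext \<circ> \<sigma>) z = deriv (\<phi> \<circ> \<sigma>) z" if z: "z \<in> unit_disk" for z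
  proof (rule DERIV_imp_deriv, rule has_field_derivative_transform_within_open[OF _ open_ball z])
    show "((\<phi> \<circ> \<sigma>) has_field_derivative deriv (\<phi> \<circ> \<sigma>) z) (at z)"
      by (rule holomorphic_derivI[OF phi_aut_holomorphic[OF assms] open_ball z])
  qed (use disk_autD(2)[OF assms] phi_in in \<open>simp add: phi_ext_def comp_op_def\<close>)
  then have "deriv_integral \<mu> p (phi_ext \<circ> \<sigma>) = deriv_integral \<mu> p (\<phi> \<circ> \<sigma>)"
    by (rule deriv_integral_cong)
  then show ?thesis
    using deriv_integral_le_MDp_norm[OF phi_ext_MDp assms] by simp
qed

section \<open>From the hyperbolic tail condition to compactness\<close>

lemma deriv_integral_T_le:
  assumes f: "f \<in> disk_analytic" and \<sigma>: "\<sigma> \<in> disk_aut"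
    and b: "\<And>z. z \<in> unit_disk \<Longrightarrow> (1 - (cmod z)\<^sup>2) * cmod (deriv f z) \<le> b"
    and s: "\<And>z. z \<in> unit_disk \<Longrightarrow> cmod z \<le> r \<Longrightarrow> cmod (deriv f z) \<le> s"
  shows "deriv_integral \<mu> p (T f \<circ> \<sigma>) \<le> ennreal (b powr p) * tail r + ennreal (s powr p) * ennreal (MN phi_ext powr p)"
proof -
  let ?A = "{z \<in> unit_disk. cmod ((\<phi> \<circ> \<sigma>) z) > r}"
  \<comment> \<open>With w = phi o sigma, the chain rule gives |f'(w) w'| <= b * w^# on the outer
    set and at most s * |w'| elsewhere. The second term is integrated over the whole disk, which
    only enlarges it.\<close>
  have "deriv_integral \<mu> p (T f \<circ> \<sigma>) \<le>
      (\<integral>\<^sup>+ z. ennreal (b powr p) * (ennreal (hyp_deriv (\<phi> \<circ> \<sigma>) z powr p) * indicator ?A z) +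
        ennreal (s powr p) * ennreal (cmod (deriv (\<phi> \<circ> \<sigma>) z) powr p) \<partial>\<mu>)"
    unfolding deriv_integral_def
  proof (rule nn_integral_mono)
    fix z assume "z \<in> space \<mu>"
    then have z: "z \<in> unit_disk" by (simp add: space_\<mu>)
    let ?w = "\<phi> (\<sigma> z)" and ?d = "deriv (\<phi> \<circ> \<sigma>) z"
    have w: "?w \<in> unit_disk"
      by (rule phi_aut_in[OF \<sigma> z])
    show "ennreal (cmod (deriv (T f \<circ> \<sigma>) z) powr p) \<le>
        ennreal (b powr p) * (ennreal (hyp_deriv (\<phi> \<circ> \<sigma>) z powr p) * indicator ?A z) +
        ennreal (s powr p) * ennreal (cmod ?d powr p)"
    proof (cases "cmod ?w > r")
      case True
      have b0: "0 \<le> b"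
        using b[of 0] order_trans[OF norm_ge_zero, of "deriv f 0" b] by simp
      have hyp0: "0 \<le> hyp_deriv (\<phi> \<circ> \<sigma>) z"
        using one_minus_sq_pos[OF w] by (simp add: hyp_deriv_def)
      have "cmod (deriv f ?w) \<le> b / (1 - (cmod ?w)\<^sup>2)"
        using b[OF w] one_minus_sq_pos[OF w] by (simp add: pos_le_divide_eq mult.commute)
      then have "cmod (deriv (T f \<circ> \<sigma>) z) \<le> b / (1 - (cmod ?w)\<^sup>2) * cmod ?d"
        unfolding deriv_T_aut[OF f \<sigma> z] norm_mult by (intro mult_right_mono) auto
      also have "\<dots> = b * hyp_deriv (\<phi> \<circ> \<sigma>) z"
        by (simp add: hyp_deriv_def)
      finally have "cmod (deriv (T f \<circ> \<sigma>) z) powr p \<le> (b * hyp_deriv (\<phi> \<circ> \<sigma>) z) powr p"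
        using p_pos by (intro powr_mono2) auto
      also have "\<dots> = b powr p * hyp_deriv (\<phi> \<circ> \<sigma>) z powr p"
        using b0 hyp0 by (simp add: powr_mult)
      finally have "ennreal (cmod (deriv (T f \<circ> \<sigma>) z) powr p) \<le>
          ennreal (b powr p) * ennreal (hyp_deriv (\<phi> \<circ> \<sigma>) z powr p)"
        by (simp add: ennreal_mult[symmetric] ennreal_leI)
      then show ?thesis
        using True z by (simp add: add_increasing2)
    next
      case False
      have "cmod (deriv (T f \<circ> \<sigma>) z) \<le> s * cmod ?d"
        unfolding deriv_T_aut[OF f \<sigma> z] norm_mult using s[OF w] False by (intro mult_right_mono) auto
      then have "cmod (deriv (T f \<circ> \<sigma>) z) powr p \<le> (s * cmod ?d) powr p"
        using p_pos by (intro powr_mono2) auto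
      also have "\<dots> = s powr p * cmod ?d powr p"
        using order_trans[OF norm_ge_zero s[OF w]] False by (simp add: powr_mult)
      finally have "ennreal (cmod (deriv (T f \<circ> \<sigma>) z) powr p) \<le> ennreal (s powr p) * ennreal (cmod ?d powr p)"
        by (simp add: ennreal_mult[symmetric] ennreal_leI)
      then show ?thesis
        by (simp add: add_increasing)
    qed
  qed
  also have "\<dots> = ennreal (b powr p) * (\<integral>\<^sup>+ z. ennreal (hyp_deriv (\<phi> \<circ> \<sigma>) z powr p) * indicator ?A z \<partial>\<mu>) +
      ennreal (s powr p) * deriv_integral \<mu> p (\<phi> \<circ> \<sigma>)"
    using borel_measurable_hyp_deriv[OF \<sigma>] borel_measurable_deriv_phi_aut[OF \<sigma>] tail_set[OF \<sigma>]
    by (simp add: nn_integral_add nn_integral_cmult deriv_integral_def)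
  also have "\<dots> \<le> ennreal (b powr p) * tail r + ennreal (s powr p) * ennreal (MN phi_ext powr p)"
    unfolding tail_def by (intro add_mono mult_left_mono phi_integral_le[OF \<sigma>] SUP_upper[OF \<sigma>]) auto
  finally show ?thesis .
qed

lemma MDp_norm_T_tendsto_0:
  assumes tail: "(tail \<longlongrightarrow> 0) (at_left 1)"
    and h: "\<And>n. h n \<in> disk_analytic"
    and b: "\<And>n z. z \<in> unit_disk \<Longrightarrow> (1 - (cmod z)\<^sup>2) * cmod (deriv (h n) z) \<le> 2"
    and pt: "(\<lambda>n. h n (\<phi> 0)) \<longlonglongrightarrow> 0"
    and unif: "\<And>r. 0 \<le> r \<Longrightarrow> r < 1 \<Longrightarrow> uniform_limit (cball 0 r) (\<lambda>n. deriv (h n)) (\<lambda>_. 0) sequentially"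
  shows "(\<lambda>n. MN (T (h n))) \<longlonglongrightarrow> 0"
proof (rule tendstoI)
  fix e :: real assume "0 < e"
  define \<epsilon> where "\<epsilon> = e / 2"
  have \<epsilon>: "0 < \<epsilon>" "\<epsilon> < e" using \<open>0 < e\<close> by (auto simp: \<epsilon>_def)
  \<comment> \<open>One third each for the value at 0, the outer part and the inner part. The added
    1 in the definition of \<open>s\<close> avoids a division by zero when \<open>\<phi>\<close> has
    norm 0.\<close>
  define \<delta> where "\<delta> = \<epsilon> powr p / 3"
  have \<delta>: "0 < \<delta>" using \<epsilon> by (simp add: \<delta>_def)
  define s where "s = (\<delta> / (MN phi_ext powr p + 1)) powr (1 / p)"
  have pp: "0 < MN phi_ext powr p + 1"
    by (simp add: add_nonneg_pos)
  have s: "0 < s" "s powr p * (MN phi_ext powr p) \<le> \<delta>"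
  proof -
    show "0 < s" using \<delta> pp by (simp add: s_def)
    have "s powr p * (MN phi_ext powr p) = \<delta> / (MN phi_ext powr p + 1) * (MN phi_ext powr p)"
      using p_pos \<delta> pp by (simp add: s_def powr_powr)
    also have "\<dots> \<le> \<delta>"
      using \<delta> pp by (simp add: pos_divide_le_eq)
    finally show "s powr p * (MN phi_ext powr p) \<le> \<delta>" .
  qed
  have "0 < ennreal (\<delta> / 2 powr p)"
    using \<delta> by simp
  then have "\<forall>\<^sub>F r in at_left 1. tail r < ennreal (\<delta> / 2 powr p)"
    by (rule order_tendstoD[OF tail])
  then obtain c where c: "c < 1" "\<And>r. c < r \<Longrightarrow> r < 1 \<Longrightarrow> tail r < ennreal (\<delta> / 2 powr p)"
    unfolding eventually_at_left_field by blast
  define r where "r = (max c 0 + 1) / 2"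
  have r: "0 \<le> r" "r < 1" "c < r"
    using c(1) by (auto simp: r_def max_def)
  have "\<forall>\<^sub>F n in sequentially. \<forall>z\<in>cball 0 r. dist (deriv (h n) z) 0 < s"
    by (rule uniform_limitD[OF unif[OF r(1,2)] s(1)])
  moreover have "\<forall>\<^sub>F n in sequentially. dist (h n (\<phi> 0)) 0 < \<delta> powr (1 / p)"
    using \<delta> by (intro tendstoD[OF pt]) simp
  ultimately show "\<forall>\<^sub>F n in sequentially. dist (MN (T (h n))) 0 < e"
  proof eventually_elim
    case (elim n)
    have "MN (T (h n)) \<le> \<epsilon>"
    proof (rule MDp_norm_leI(2)[OF T_analytic[OF h], where t = "2 * \<delta>"])
      have "cmod (T (h n) 0) powr p \<le> (\<delta> powr (1 / p)) powr p"
        using elim(2) p_pos by (intro powr_mono2) (auto simp: comp_op_def)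
      also have "\<dots> = \<delta>"
        using \<delta> p_pos by (simp add: powr_powr)
      finally show "cmod (T (h n) 0) powr p + 2 * \<delta> \<le> \<epsilon> powr p"
        by (simp add: \<delta>_def)
      fix \<sigma> assume \<sigma>: "\<sigma> \<in> disk_aut"
      have "deriv_integral \<mu> p (T (h n) \<circ> \<sigma>) \<le>
          ennreal (2 powr p) * tail r + ennreal (s powr p) * ennreal (MN phi_ext powr p)"
        using elim(1) by (intro deriv_integral_T_le[OF h \<sigma> b]) (auto intro: less_imp_le)
      also have "\<dots> \<le> ennreal (2 powr p) * ennreal (\<delta> / 2 powr p) + ennreal \<delta>"
        using c(2)[OF r(3,2)] s(2)
        by (intro add_mono mult_left_mono) (auto simp: ennreal_mult[symmetric] ennreal_leI)
      also have "\<dots> = ennreal (2 * \<delta>)"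
        using \<delta> by (simp add: ennreal_mult[symmetric] ennreal_plus[symmetric] del: ennreal_plus)
      finally show "deriv_integral \<mu> p (T (h n) \<circ> \<sigma>) \<le> ennreal (2 * \<delta>)" .
    qed (use \<epsilon> \<delta> in auto)
    then show ?case
      using \<epsilon> MDp_norm_nonneg[of "T (h n)"] by simp
  qed
qed

lemma tail_imp_compact:
  assumes tail: "(tail \<longlongrightarrow> 0) (at_left 1)"
  shows "compact_operator bloch_space bloch_norm M MN T"
proof -
  interpret Metric_space M "fun_dist MN" by (rule MDp_metric)
  let ?B = "T ` {f \<in> bloch_space. bloch_norm f \<le> 1}"
  have TM: "T f \<in> M" if "f \<in> bloch_space" for f
    using bounded that by (simp add: bounded_operator_def)
  \<comment> \<open>The image of the closed unit ball is itself compact, because the limit given by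
    Montel's theorem lies in that ball; taking the closure adds nothing.\<close>
  have comp: "compactin mtopology ?B"
    unfolding compactin_sequentially
  proof (intro conjI allI impI)
    show "?B \<subseteq> M" using TM by blast
    fix y :: "nat \<Rightarrow> complex \<Rightarrow> complex" assume "range y \<subseteq> ?B"
    then have "\<forall>n. \<exists>f. f \<in> bloch_space \<and> bloch_norm f \<le> 1 \<and> y n = T f"
      by blast
    from choice[OF this] obtain F where F: "\<And>n. F n \<in> bloch_space" "\<And>n. bloch_norm (F n) \<le> 1"
        and y: "\<And>n. y n = T (F n)"
      by blast
    obtain g \<rho> where \<rho>: "strict_mono (\<rho> :: nat \<Rightarrow> nat)" and g: "g \<in> bloch_space" "bloch_norm g \<le> 1"
      and pt: "\<And>z. (\<lambda>n. F (\<rho> n) z) \<longlonglongrightarrow> g z"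
      and unif: "\<And>r. 0 \<le> r \<Longrightarrow> r < 1 \<Longrightarrow> uniform_limit (cball 0 r) (\<lambda>n. deriv (F (\<rho> n))) (deriv g) sequentially"
      by (rule bloch_unit_ball_sequence[OF F], rule that)
    \<comment> \<open>A difference of two members of the unit ball, whence the bound 2 on its Bloch
      seminorm below.\<close>
    define h where "h n z = F (\<rho> n) z - g z" for n z
    have an: "F n \<in> disk_analytic" "g \<in> disk_analytic" for n
      using F(1) g(1) by (auto simp: bloch_space_def)
    have dh: "deriv (h n) z = deriv (F (\<rho> n)) z - deriv g z" if "z \<in> unit_disk" for n z
      using deriv_diff[OF holomorphic_on_imp_differentiable_at[OF disk_analytic_holomorphic[OF an(1)] open_ball that]
          holomorphic_on_imp_differentiable_at[OF disk_analytic_holomorphic[OF an(2)] open_ball that]]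
      by (simp add: h_def[abs_def])
    have "(\<lambda>n. MN (T (h n))) \<longlonglongrightarrow> 0"
    proof (rule MDp_norm_T_tendsto_0[OF tail])
      show "h n \<in> disk_analytic" for n
        using disk_analytic_add[OF an(1) disk_analytic_scale[OF an(2), of "- 1"], of "\<rho> n"]
        by (simp add: h_def[abs_def])
      show "(1 - (cmod z)\<^sup>2) * cmod (deriv (h n) z) \<le> 2" if z: "z \<in> unit_disk" for n z
      proof -
        have "(1 - (cmod z)\<^sup>2) * cmod (deriv f z) \<le> 1" if "f \<in> bloch_space" "bloch_norm f \<le> 1" for f
          using order_trans[OF bloch_deriv_le[OF that(1) z] that(2)] norm_ge_zero[of "f 0"] by linarith
        from this[OF F, of "\<rho> n"] this[OF g]
        have "(1 - (cmod z)\<^sup>2) * (cmod (deriv (F (\<rho> n)) z) + cmod (deriv g z)) \<le> 2"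
          by (simp add: ring_distribs)
        moreover have "(1 - (cmod z)\<^sup>2) * cmod (deriv (h n) z) \<le>
            (1 - (cmod z)\<^sup>2) * (cmod (deriv (F (\<rho> n)) z) + cmod (deriv g z))"
          unfolding dh[OF z] using one_minus_sq_pos[OF z] by (intro mult_left_mono norm_triangle_ineq4) auto
        ultimately show ?thesis by linarith
      qed
      show "(\<lambda>n. h n (\<phi> 0)) \<longlonglongrightarrow> 0"
        using tendsto_diff[OF pt[of "\<phi> 0"] tendsto_const[of "g (\<phi> 0)"]] by (simp add: h_def)
      show "uniform_limit (cball 0 r) (\<lambda>n. deriv (h n)) (\<lambda>_. 0) sequentially" if r: "0 \<le> r" "r < 1" for r
      proof (rule uniform_limitI)
        fix e :: real assume "0 < e"
        from uniform_limitD[OF unif[OF r] this]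
        show "\<forall>\<^sub>F n in sequentially. \<forall>z\<in>cball 0 r. dist (deriv (h n) z) 0 < e"
          by eventually_elim (use r dh in \<open>auto simp: dist_norm\<close>)
      qed
    qed
    moreover have "T (h n) = (\<lambda>z. T (F (\<rho> n)) z - T g z)" for n
      by (auto simp: comp_op_def h_def)
    ultimately have "limitin mtopology (y \<circ> \<rho>) (T g) sequentially"
      unfolding limit_metric_sequentially using TM[OF g(1)] TM[OF F(1)]
      by (auto simp: y fun_dist_def LIMSEQ_iff MDp_norm_nonneg)
    then show "\<exists>l r. l \<in> ?B \<and> strict_mono r \<and> limitin mtopology (y \<circ> r) l sequentially"
      using \<rho> g by blast
  qed
  then have "closedin mtopology ?B"
    by (rule compactin_imp_closedin[OF Hausdorff_space_mtopology])
  then have "mtopology closure_of ?B = ?B"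
    by (simp add: closure_of_eq)
  with comp bounded show ?thesis
    by (simp add: compact_operator_def norm_topology_def)
qed

section \<open>From weak compactness to the hyperbolic tail condition\<close>

lemma T_bounded:
  obtains C where "0 \<le> C" "\<And>f. f \<in> bloch_space \<Longrightarrow> bloch_norm f \<le> 1 \<Longrightarrow> MN (T f) \<le> C"
proof -
  obtain C where C: "\<And>f. f \<in> bloch_space \<Longrightarrow> MN (T f) \<le> C * bloch_norm f"
    using bounded unfolding bounded_operator_def by blast
  have "MN (T f) \<le> \<bar>C\<bar>" if "f \<in> bloch_space" "bloch_norm f \<le> 1" for f
  proof -
    have "C * bloch_norm f \<le> \<bar>C\<bar> * 1"
      using that bloch_norm_nonneg[OF that(1)] by (intro mult_mono) auto
    with C[OF that(1)] show ?thesis by simp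
  qed
  then show thesis
    using that[of "\<bar>C\<bar>"] by simp
qed

lemma T_lacunary_MDp:
  assumes "\<And>n. cmod (c n) \<le> B"
  shows "T (lacunary c) \<in> M"
  using bounded lacunary_bloch(1)[of c B, OF assms] unfolding bounded_operator_def by blast

text \<open>A failure of uniformity yields disjoint blocks \<open>[t j, t (Suc j))\<close> of coefficients and automorphisms
  contradicting the \<open>\<ell>\<^sup>\<infinity>\<close> lemma for the operator that multiplies the \<open>j\<close>-th block by the \<open>j\<close>-th entry.
  The bound \<open>1 / 6\<close> on the coefficients keeps the series in the unit ball of the Bloch space.\<close>

lemma weakly_compact_imp_lacunary_small:
  assumes wc: "weakly_compact_operator bloch_space bloch_norm M MN T" and "0 < \<delta>"
  shows "\<exists>N. \<forall>c n \<sigma>. (\<forall>k. cmod (c k) \<le> 1 / 6) \<longrightarrow> (\<forall>k. c k \<noteq> 0 \<longrightarrow> N \<le> k \<and> k < n) \<longrightarrow>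
    \<sigma> \<in> disk_aut \<longrightarrow> deriv_integral \<mu> p (T (lacunary c) \<circ> \<sigma>) \<le> ennreal \<delta>"
proof (rule ccontr)
  assume "\<not> ?thesis"
  then have "\<forall>N. \<exists>c n \<sigma>. (\<forall>k. cmod (c k) \<le> 1 / 6) \<and> (\<forall>k. c k \<noteq> 0 \<longrightarrow> N \<le> k \<and> k < n) \<and>
      \<sigma> \<in> disk_aut \<and> ennreal \<delta> < deriv_integral \<mu> p (T (lacunary c) \<circ> \<sigma>)"
    by (simp only: not_ex not_all not_imp not_le simp_thms)
  from choice[OF this] obtain c0 where
    "\<forall>N. \<exists>n \<sigma>. (\<forall>k. cmod (c0 N k) \<le> 1 / 6) \<and> (\<forall>k. c0 N k \<noteq> 0 \<longrightarrow> N \<le> k \<and> k < n) \<and>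
      \<sigma> \<in> disk_aut \<and> ennreal \<delta> < deriv_integral \<mu> p (T (lacunary (c0 N)) \<circ> \<sigma>)" by blast
  from choice[OF this] obtain n0 where
    "\<forall>N. \<exists>\<sigma>. (\<forall>k. cmod (c0 N k) \<le> 1 / 6) \<and> (\<forall>k. c0 N k \<noteq> 0 \<longrightarrow> N \<le> k \<and> k < n0 N) \<and>
      \<sigma> \<in> disk_aut \<and> ennreal \<delta> < deriv_integral \<mu> p (T (lacunary (c0 N)) \<circ> \<sigma>)" by blast
  from choice[OF this] obtain \<sigma>0 where
    c0: "\<And>N k. cmod (c0 N k) \<le> 1 / 6" and supp0: "\<And>N k. c0 N k \<noteq> 0 \<Longrightarrow> N \<le> k \<and> k < n0 N"
    and \<sigma>0: "\<And>N. \<sigma>0 N \<in> disk_aut"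
    and big0: "\<And>N. ennreal \<delta> < deriv_integral \<mu> p (T (lacunary (c0 N)) \<circ> \<sigma>0 N)"
    by blast
  \<comment> \<open>Each block starts past the support of the series chosen for the previous one.
    The \<open>Suc m\<close> forces strict growth even when that support is empty.\<close>
  define t where "t = rec_nat 0 (\<lambda>_ m. max (Suc m) (n0 m))"
  have t_Suc: "t (Suc j) = max (Suc (t j)) (n0 (t j))" for j
    by (simp add: t_def)
  have t_mono: "t i \<le> t j" if "i \<le> j" for i j
    using that by (rule lift_Suc_mono_le[rotated]) (simp add: t_Suc)
  have t_ge: "j \<le> t j" for j
    by (induction j) (auto simp: t_Suc)
  define e where "e j = c0 (t j)" for j
  have e_le: "cmod (e j k) \<le> 1 / 6" for j k
    unfolding e_def by (rule c0)
  have e_supp: "t j \<le> k \<and> k < t (Suc j)" if "e j k \<noteq> 0" for j k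
    using supp0[of "t j" k] that by (auto simp: e_def t_Suc)
  have e_disj: "i = j" if "e i k \<noteq> 0" "e j k \<noteq> 0" for i j k
  proof (rule ccontr)
    assume "i \<noteq> j"
    then have "Suc i \<le> j \<or> Suc j \<le> i" by auto
    then show False
      using t_mono[of "Suc i" j] t_mono[of "Suc j" i] e_supp[OF that(1)] e_supp[OF that(2)] by linarith
  qed
  \<comment> \<open>Block \<open>j\<close> starts at \<open>t j\<close>, which is at least
    \<open>j\<close>, so blocks with \<open>j > k\<close> do not meet the coordinate
    \<open>k\<close> and a finite sum suffices. At most one of its summands is nonzero.\<close>
  define coef where "coef w k = (\<Sum>j\<le>k. w j * e j k)" for w k
  have coef_le: "cmod (coef w k) \<le> B / 6" if w: "\<And>j. cmod (w j) \<le> B" for w k B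
  proof (cases "\<exists>i\<le>k. e i k \<noteq> 0")
    case True
    then obtain i where i: "i \<le> k" "e i k \<noteq> 0" by blast
    have "e j k = 0" if "j \<noteq> i" for j
      using e_disj[OF i(2), of j] that by blast
    then have "coef w k = (\<Sum>j\<in>{i}. w j * e j k)"
      unfolding coef_def using i(1) by (intro sum.mono_neutral_right) simp_all
    then have "cmod (coef w k) = cmod (w i) * cmod (e i k)"
      by (simp add: norm_mult)
    also have "\<dots> \<le> B * (1 / 6)"
      using w[of i] e_le order_trans[OF norm_ge_zero w[of i]] by (intro mult_mono) auto
    finally show ?thesis by simp
  next
    case False
    then have "coef w k = 0"
      by (simp add: coef_def)
    then show ?thesis
      using order_trans[OF norm_ge_zero w[of 0]] by simp
  qed
  have coef_unit: "coef (seq_unit i) = e i" for i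
  proof
    fix k
    have "coef (seq_unit i) k = (\<Sum>j\<le>k. if j = i then e i k else 0)"
      unfolding coef_def seq_unit_def by (rule sum.cong) auto
    also have "\<dots> = (if i \<le> k then e i k else 0)"
      by simp
    also have "\<dots> = e i k"
      using e_supp[of i k] t_ge[of i] by (cases "e i k = 0") auto
    finally show "coef (seq_unit i) k = e i k" .
  qed
  define V where "V w = T (lacunary (coef w))" for w
  have ball: "lacunary (coef w) \<in> bloch_space" "bloch_norm (lacunary (coef w)) \<le> 1"
    if "\<And>j. cmod (w j) \<le> 1" for w
    using lacunary_bloch[of "coef w" "1 / 6"] coef_le[of w 1] that by auto
  obtain C where C: "0 \<le> C" "\<And>f. f \<in> bloch_space \<Longrightarrow> bloch_norm f \<le> 1 \<Longrightarrow> MN (T f) \<le> C"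
    using T_bounded by metis
  define K where "K = weak_topology M MN closure_of (T ` {f \<in> bloch_space. bloch_norm f \<le> 1})"
  have T_in_K: "T f \<in> K" if "f \<in> bloch_space" "bloch_norm f \<le> 1" for f
  proof -
    have "T ` {f \<in> bloch_space. bloch_norm f \<le> 1} \<subseteq> M"
      using bounded unfolding bounded_operator_def by blast
    then have "T ` {f \<in> bloch_space. bloch_norm f \<le> 1} \<subseteq> K"
      unfolding K_def by (intro closure_of_subset) (simp add: topspace_weak_topology)
    then show ?thesis using that by blast
  qed
  define y where "y i = T (lacunary (e i))" for i
  have yM: "y i \<in> M" for i
    unfolding y_def using e_le by (rule T_lacunary_MDp)
  have y_le: "MN (y i) \<le> C" for i
    unfolding y_def using lacunary_bloch[of "e i" "1 / 6", OF e_le] by (intro C(2)) auto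
  \<comment> \<open>The functionals are uniformly bounded because every \<open>y i\<close> is the
    image of a member of the Bloch unit ball, so \<open>MN (y i)\<close> is at most \<open>C\<close>
    for all \<open>i\<close>.\<close>
  have "\<exists>i. cmod (norming (\<sigma>0 (t i)) (y i) (V (seq_unit i))) < \<delta>"
  proof (rule weakly_compact_linfinity_null[where V = V and l = "\<lambda>i. norming (\<sigma>0 (t i)) (y i)" and
        Y = M and N = MN and K = K and C = C and L = "1 + C powr p"])
    show "(\<lambda>f. f z) \<in> fun_dual M MN" for z
      by (rule MDp_evaluation)
    show "0 \<le> MN f" for f by (rule MDp_norm_nonneg)
    show "(\<lambda>x. f x + g x) \<in> M" if "f \<in> M" "g \<in> M" for f g
      using MDp_add[OF that] by blast
    show "(\<lambda>x. c * f x) \<in> M" if "f \<in> M" for f c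
      using MDp_scale_le[OF that] by blast
    show "V w \<in> M" if "\<And>j. cmod (w j) \<le> B" for w B
      unfolding V_def using coef_le[OF that] by (rule T_lacunary_MDp)
    show "V (\<lambda>j. u j + w j) = (\<lambda>x. V u x + V w x)"
      if "\<And>j. cmod (u j) \<le> B" "\<And>j. cmod (w j) \<le> B" for u w B
    proof -
      have "coef (\<lambda>j. u j + w j) = (\<lambda>k. coef u k + coef w k)"
        by (simp add: coef_def fun_eq_iff ring_distribs sum.distrib)
      moreover have "lacunary (\<lambda>k. coef u k + coef w k) = (\<lambda>z. lacunary (coef u) z + lacunary (coef w) z)"
        using coef_le[OF that(1)] coef_le[OF that(2)] by (rule lacunary_add)
      ultimately have "V (\<lambda>j. u j + w j) = T (\<lambda>z. lacunary (coef u) z + lacunary (coef w) z)"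
        by (simp only: V_def)
      then show ?thesis
        by (simp add: V_def comp_op_def fun_eq_iff)
    qed
    show "V (\<lambda>j. c * w j) = (\<lambda>x. c * V w x)" if "\<And>j. cmod (w j) \<le> B" for w B c
    proof -
      have "coef (\<lambda>j. c * w j) = (\<lambda>k. c * coef w k)"
        by (simp add: coef_def fun_eq_iff sum_distrib_left mult.assoc)
      moreover have "lacunary (\<lambda>k. c * coef w k) = (\<lambda>z. c * lacunary (coef w) z)"
        using coef_le[OF that] by (rule lacunary_scale)
      ultimately have "V (\<lambda>j. c * w j) = T (\<lambda>z. c * lacunary (coef w) z)"
        by (simp only: V_def)
      then show ?thesis
        by (simp add: V_def comp_op_def fun_eq_iff)
    qed
    show "MN (V w) \<le> C" if "\<And>j. cmod (w j) \<le> 1" for w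
      unfolding V_def by (rule C(2)[OF ball[OF that]])
    show "compactin (weak_topology M MN) K"
      using wc by (simp add: weakly_compact_operator_def K_def)
    show "V w \<in> K" if "\<And>j. cmod (w j) \<le> 1" for w
      unfolding V_def by (rule T_in_K[OF ball[OF that]])
    show "(\<lambda>m. V (\<lambda>j. if j < m then w j else 0) x) \<longlonglongrightarrow> V w x" if w: "\<And>j. cmod (w j) \<le> 1" for w x
    proof (cases "x \<in> unit_disk")
      case True
      have "(\<lambda>m. lacunary (coef (\<lambda>j. if j < m then w j else 0)) (\<phi> x)) \<longlonglongrightarrow> lacunary (coef w) (\<phi> x)"
      proof (rule lacunary_tendsto)
        show "cmod (coef (\<lambda>j. if j < m then w j else 0) k) \<le> 1 / 6" for m k
          by (rule coef_le) (simp add: w)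
        show "(\<lambda>m. coef (\<lambda>j. if j < m then w j else 0) k) \<longlonglongrightarrow> coef w k" for k
        proof (rule tendsto_eventually)
          show "\<forall>\<^sub>F m in sequentially. coef (\<lambda>j. if j < m then w j else 0) k = coef w k"
            using eventually_gt_at_top[of k]
            by eventually_elim (auto simp: coef_def intro!: sum.cong)
        qed
      qed
      with True show ?thesis
        by (simp add: V_def comp_op_def)
    qed (simp add: V_def comp_op_def)
    show "norming (\<sigma>0 (t i)) (y i) \<in> fun_dual M MN" for i
      by (rule norming_in_dual[OF \<sigma>0 yM])
    show "cmod (norming (\<sigma>0 (t i)) (y i) f) \<le> (1 + C powr p) * MN f" if "f \<in> M" for i f
    proof (rule order_trans[OF norming_bounded[OF \<sigma>0 yM that]])
      show "(1 + MN (y i) powr p) * MN f \<le> (1 + C powr p) * MN f"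
        using y_le MDp_norm_nonneg p_pos by (intro mult_right_mono add_left_mono powr_mono2) auto
    qed
  qed (rule \<open>0 < \<delta>\<close>)
  then obtain i where i: "cmod (norming (\<sigma>0 (t i)) (y i) (V (seq_unit i))) < \<delta>"
    by blast
  have "V (seq_unit i) = y i"
    by (simp add: V_def y_def coef_unit)
  \<comment> \<open>The \<open>i\<close>-th functional is evaluated at the very function that it
    norms, so its small value is the integral that was chosen large.\<close>
  then have "deriv_integral \<mu> p (y i \<circ> \<sigma>0 (t i)) < ennreal \<delta>"
    using i norming_self[OF \<sigma>0 yM, of "t i" i] \<open>0 < \<delta>\<close> by (metis ennreal_less_iff norm_ge_zero)
  moreover have "ennreal \<delta> < deriv_integral \<mu> p (y i \<circ> \<sigma>0 (t i))"
    using big0[of "t i"] by (simp add: y_def e_def)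
  ultimately show False by simp
qed

text \<open>The constant 48 is 8 * 6, from the lower bound on a single term and from the
  normalisation of the coefficients; the 2 is the loss in \<open>sign_average\<close>. The estimate
  does not depend on the number of terms, so monotone convergence removes the truncation.\<close>

lemma lacunary_small_imp_tail_le:
  assumes small: "\<And>c n \<sigma>. (\<And>k. cmod (c k) \<le> 1 / 6) \<Longrightarrow> (\<And>k. c k \<noteq> 0 \<Longrightarrow> N \<le> k \<and> k < n) \<Longrightarrow>
      \<sigma> \<in> disk_aut \<Longrightarrow> deriv_integral \<mu> p (T (lacunary c) \<circ> \<sigma>) \<le> ennreal \<delta>"
    and r: "1 - 1 / 2 ^ Suc N \<le> r" and "0 \<le> \<delta>"
  shows "tail r \<le> ennreal (48 powr p * (2 * \<delta>))"
  unfolding tail_def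
proof (rule SUP_least)
  fix \<sigma> assume \<sigma>: "\<sigma> \<in> disk_aut"
  let ?w = "\<phi> \<circ> \<sigma>"
  let ?A = "{z \<in> unit_disk. cmod (?w z) > r}"
  \<comment> \<open>The division by 6 makes sign sums of the \<open>a k\<close> derivatives of
    images of admissible lacunary polynomials.\<close>
  define a where "a k z = 2 ^ k * ?w z ^ (2 ^ k - 1) * deriv ?w z / 6" for k z
  have [measurable]: "?w \<in> borel_measurable \<mu>" "deriv ?w \<in> borel_measurable \<mu>"
    using \<sigma> by (rule borel_measurable_phi_aut borel_measurable_deriv_phi_aut)+
  have [measurable]: "a k \<in> borel_measurable \<mu>" for k
    unfolding a_def[abs_def] by measurable
  \<comment> \<open>Truncated at \<open>m\<close> because the assumption covers finitely supported
    coefficients. The supremum stands inside the integral, as the relevant term varies with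
    \<open>z\<close>.\<close>
  define u where "u m z = (SUP k\<in>{N..<m}. ennreal (cmod (a k z) powr p))" for m z
  have u_meas [measurable]: "u m \<in> borel_measurable \<mu>" for m
    unfolding u_def[abs_def] by (rule borel_measurable_SUP) auto
  have u_inc: "incseq u"
    by (auto simp: incseq_def le_fun_def u_def intro!: SUP_subset_mono)
  have u_int: "(\<integral>\<^sup>+ z. u m z \<partial>\<mu>) \<le> ennreal (2 * \<delta>)" for m
  proof -
    define F where "F = {N..<m}"
    define c where "c P k = (if k \<in> F then (if k \<in> P then 1 / 6 else - 1 / 6) else (0::complex))" for P k
    have F: "finite F" by (simp add: F_def)
    have c_le: "cmod (c P k) \<le> 1 / 6" for P k
      by (simp add: c_def)
    have c_supp: "N \<le> k \<and> k < m" if "c P k \<noteq> 0" for P k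
      using that by (auto simp: c_def F_def split: if_splits)
    have an: "lacunary (c P) \<in> disk_analytic" for P
      using lacunary_bloch(1)[of "c P", OF c_le] by (simp add: bloch_space_def)
    have deriv: "deriv (T (lacunary (c P)) \<circ> \<sigma>) z = (\<Sum>k\<in>F. (if k \<in> P then 1 else - 1) * a k z)"
      if z: "z \<in> unit_disk" for P z
    proof -
      have "deriv (lacunary (c P)) (\<phi> (\<sigma> z)) = (\<Sum>k\<in>F. c P k * (2 ^ k * \<phi> (\<sigma> z) ^ (2 ^ k - 1)))"
        by (rule lacunary_finite_deriv[OF F _ phi_aut_in[OF \<sigma> z]]) (simp add: c_def)
      then show ?thesis
        unfolding deriv_T_aut[OF an \<sigma> z] by (auto simp: sum_distrib_right a_def c_def intro!: sum.cong)
    qed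
    \<comment> \<open>Twice the reciprocal of the number of sign patterns: a sum over all patterns
      becomes twice their average.\<close>
    define q where "q = 2 / (2::real) ^ card F"
    have q: "0 \<le> q" by (simp add: q_def)
    have meas: "(\<lambda>z. ennreal (cmod (deriv (T (lacunary (c P)) \<circ> \<sigma>) z) powr p)) \<in> borel_measurable \<mu>" for P
    proof -
      have [measurable]: "deriv (T (lacunary (c P)) \<circ> \<sigma>) \<in> borel_measurable \<mu>"
        by (intro deriv_borel_measurable holomorphic_comp_aut T_analytic an \<sigma>)
      show ?thesis by measurable
    qed
    have "(\<integral>\<^sup>+ z. u m z \<partial>\<mu>) \<le>
        (\<integral>\<^sup>+ z. ennreal q * (\<Sum>P\<in>Pow F. ennreal (cmod (deriv (T (lacunary (c P)) \<circ> \<sigma>) z) powr p)) \<partial>\<mu>)"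
    proof (rule nn_integral_mono)
      fix z assume "z \<in> space \<mu>"
      then have z: "z \<in> unit_disk" by (simp add: space_\<mu>)
      show "u m z \<le> ennreal q * (\<Sum>P\<in>Pow F. ennreal (cmod (deriv (T (lacunary (c P)) \<circ> \<sigma>) z) powr p))"
        unfolding u_def
      proof (rule SUP_least)
        fix k assume "k \<in> {N..<m}"
        then have k: "k \<in> F" by (simp add: F_def)
        have "2 ^ card F * cmod (a k z) powr p \<le>
            2 * (\<Sum>P\<in>Pow F. cmod (deriv (T (lacunary (c P)) \<circ> \<sigma>) z) powr p)"
          unfolding deriv[OF z] by (rule sign_average[OF F k p_ge_1])
        then have "cmod (a k z) powr p \<le> q * (\<Sum>P\<in>Pow F. cmod (deriv (T (lacunary (c P)) \<circ> \<sigma>) z) powr p)"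
          by (simp add: q_def pos_le_divide_eq mult.commute)
        then have "ennreal (cmod (a k z) powr p) \<le>
            ennreal (q * (\<Sum>P\<in>Pow F. cmod (deriv (T (lacunary (c P)) \<circ> \<sigma>) z) powr p))"
          by (rule ennreal_leI)
        also have "\<dots> = ennreal q * (\<Sum>P\<in>Pow F. ennreal (cmod (deriv (T (lacunary (c P)) \<circ> \<sigma>) z) powr p))"
          using q by (simp add: ennreal_mult sum_nonneg)
        finally show "ennreal (cmod (a k z) powr p) \<le>
            ennreal q * (\<Sum>P\<in>Pow F. ennreal (cmod (deriv (T (lacunary (c P)) \<circ> \<sigma>) z) powr p))" .
      qed
    qed
    also have "\<dots> = ennreal q * (\<Sum>P\<in>Pow F. deriv_integral \<mu> p (T (lacunary (c P)) \<circ> \<sigma>))"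
      unfolding deriv_integral_def using meas by (simp add: nn_integral_cmult nn_integral_sum del: sum_ennreal)
    also have "\<dots> \<le> ennreal q * (\<Sum>P\<in>Pow F. ennreal \<delta>)"
      using c_le c_supp \<sigma> by (intro mult_left_mono sum_mono small) auto
    also have "\<dots> = ennreal q * ennreal (2 ^ card F * \<delta>)"
      using F \<open>0 \<le> \<delta>\<close> by (simp add: card_Pow ennreal_mult ennreal_of_nat_eq_real_of_nat)
    also have "\<dots> = ennreal (2 * \<delta>)"
      using q \<open>0 \<le> \<delta>\<close> by (simp add: q_def ennreal_mult[symmetric])
    finally show ?thesis .
  qed
  have hyp_le: "ennreal (hyp_deriv ?w z powr p) * indicator ?A z \<le> ennreal (48 powr p) * (SUP m. u m z)" for z
  proof (cases "z \<in> ?A")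
    case True
    then have z: "z \<in> unit_disk" and zr: "r < cmod (?w z)" by auto
    have w: "?w z \<in> unit_disk"
      using phi_aut_in[OF \<sigma> z] by simp
    \<comment> \<open>The threshold on \<open>r\<close> is the one that makes this index at least
      \<open>N\<close>, where the coefficients are allowed to live.\<close>
    obtain k where k: "N \<le> k" "1 / (8 * (1 - (cmod (?w z))\<^sup>2)) \<le> 2 ^ k * cmod (?w z) ^ (2 ^ k - 1)"
      using lacunary_term_lower_bound[of N "cmod (?w z)"] r zr w by auto
    have hyp0: "0 \<le> hyp_deriv ?w z"
      using one_minus_sq_pos[OF w] by (simp add: hyp_deriv_def)
    have "hyp_deriv ?w z = 48 * ((1 / (8 * (1 - (cmod (?w z))\<^sup>2))) * cmod (deriv ?w z) / 6)"
    proof -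
      have "d / D = 48 * ((1 / (8 * D)) * d / 6)" for d D :: real
        by (cases "D = 0") simp_all
      then show ?thesis unfolding hyp_deriv_def .
    qed
    also have "\<dots> \<le> 48 * ((2 ^ k * cmod (?w z) ^ (2 ^ k - 1)) * cmod (deriv ?w z) / 6)"
      using k(2) by (intro mult_left_mono divide_right_mono mult_right_mono) auto
    also have "\<dots> = 48 * cmod (a k z)"
      by (simp add: a_def norm_mult norm_power norm_divide)
    finally have "hyp_deriv ?w z powr p \<le> (48 * cmod (a k z)) powr p"
      using hyp0 p_pos by (intro powr_mono2) auto
    also have "\<dots> = 48 powr p * cmod (a k z) powr p"
      by (simp add: powr_mult)
    finally have "ennreal (hyp_deriv ?w z powr p) \<le> ennreal (48 powr p) * ennreal (cmod (a k z) powr p)"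
      by (simp add: ennreal_mult[symmetric] ennreal_leI)
    also have "\<dots> \<le> ennreal (48 powr p) * u (Suc k) z"
      unfolding u_def using k(1) by (intro mult_left_mono SUP_upper) auto
    also have "\<dots> \<le> ennreal (48 powr p) * (SUP m. u m z)"
      by (intro mult_left_mono SUP_upper) auto
    finally show ?thesis
      using True by simp
  qed simp
  have "(\<integral>\<^sup>+ z \<in> ?A. ennreal (hyp_deriv ?w z powr p) \<partial>\<mu>) \<le> (\<integral>\<^sup>+ z. ennreal (48 powr p) * (SUP m. u m z) \<partial>\<mu>)"
    by (intro nn_integral_mono hyp_le)
  also have "\<dots> = ennreal (48 powr p) * (SUP m. \<integral>\<^sup>+ z. u m z \<partial>\<mu>)"
    using nn_integral_monotone_convergence_SUP[OF u_inc u_meas] by (simp add: nn_integral_cmult)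
  also have "\<dots> \<le> ennreal (48 powr p) * ennreal (2 * \<delta>)"
    by (intro mult_left_mono SUP_least u_int) auto
  also have "\<dots> = ennreal (48 powr p * (2 * \<delta>))"
    using \<open>0 \<le> \<delta>\<close> by (simp add: ennreal_mult)
  finally show "(\<integral>\<^sup>+ z \<in> ?A. ennreal (hyp_deriv ?w z powr p) \<partial>\<mu>) \<le> ennreal (48 powr p * (2 * \<delta>))" .
qed

lemma weakly_compact_imp_tail:
  assumes wc: "weakly_compact_operator bloch_space bloch_norm M MN T"
  shows "(tail \<longlongrightarrow> 0) (at_left 1)"
proof (rule order_tendstoI)
  fix b :: ennreal assume "0 < b"
  \<comment> \<open>\<open>b\<close> may be infinite, so a positive real below it is fixed first;
    \<open>\<delta>\<close> then undoes the factor lost in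
    \<open>lacunary_small_imp_tail_le\<close>.\<close>
  obtain \<epsilon> where \<epsilon>: "0 < \<epsilon>" "ennreal \<epsilon> < b"
  proof (cases b)
    case (real x)
    then show thesis
      using \<open>0 < b\<close> that[of "x / 2"] by (auto simp: ennreal_less_iff)
  next
    case top
    then show thesis using that[of 1] by simp
  qed
  define \<delta> where "\<delta> = \<epsilon> / (2 * 48 powr p)"
  have \<delta>: "0 < \<delta>" "48 powr p * (2 * \<delta>) = \<epsilon>"
    using \<epsilon>(1) by (auto simp: \<delta>_def)
  obtain N where N: "\<forall>c n \<sigma>. (\<forall>k. cmod (c k) \<le> 1 / 6) \<longrightarrow> (\<forall>k. c k \<noteq> 0 \<longrightarrow> N \<le> k \<and> k < n) \<longrightarrow>
      \<sigma> \<in> disk_aut \<longrightarrow> deriv_integral \<mu> p (T (lacunary c) \<circ> \<sigma>) \<le> ennreal \<delta>"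
    using weakly_compact_imp_lacunary_small[OF wc \<delta>(1)] by (elim exE)
  have "tail r < b" if "1 - 1 / 2 ^ Suc N < r" for r
  proof -
    have "tail r \<le> ennreal (48 powr p * (2 * \<delta>))"
      using that \<delta>(1) N by (intro lacunary_small_imp_tail_le[of N]) auto
    with \<delta>(2) \<epsilon>(2) show ?thesis by simp
  qed
  then show "\<forall>\<^sub>F r in at_left 1. tail r < b"
    unfolding eventually_at_left_field by (intro exI[of _ "1 - 1 / 2 ^ Suc N"]) auto
qed simp

lemma compact_weakly_compact_tail:
  "(compact_operator bloch_space bloch_norm M MN T \<longleftrightarrow> weakly_compact_operator bloch_space bloch_norm M MN T) \<and>
   (weakly_compact_operator bloch_space bloch_norm M MN T \<longleftrightarrow> (tail \<longlongrightarrow> 0) (at_left 1))"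
  using compact_operator_imp_weakly_compact[OF MDp_normed MDp_metric MDp_evaluation]
    weakly_compact_imp_tail tail_imp_compact by blast

end

theorem theorem1:
  fixes p :: real and \<mu> :: "complex measure" and \<phi> :: "complex \<Rightarrow> complex"
  assumes "1 \<le> p"
    and "disk_borel_measure \<mu>"
    and "Dp_axiom \<mu> p"
    and "disk_self_map \<phi>"
    and "bounded_operator bloch_space bloch_norm (MDp_space \<mu> p) (MDp_norm \<mu> p) (comp_op \<phi>)"
  shows "(compact_operator bloch_space bloch_norm (MDp_space \<mu> p) (MDp_norm \<mu> p) (comp_op \<phi>)
      \<longleftrightarrow> weakly_compact_operator bloch_space bloch_norm (MDp_space \<mu> p) (MDp_norm \<mu> p) (comp_op \<phi>))
    \<and> (weakly_compact_operator bloch_space bloch_norm (MDp_space \<mu> p) (MDp_norm \<mu> p) (comp_op \<phi>)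
      \<longleftrightarrow> ((\<lambda>r. SUP \<sigma>\<in>disk_aut. \<integral>\<^sup>+ z \<in> {z \<in> unit_disk. cmod ((\<phi> \<circ> \<sigma>) z) > r}.
              ennreal (hyp_deriv (\<phi> \<circ> \<sigma>) z powr p) \<partial>\<mu>) \<longlongrightarrow> 0) (at_left (1::real)))"
proof -
  interpret bloch_composition \<mu> p \<phi>
    by unfold_locales (rule assms)+
  show ?thesis
    using compact_weakly_compact_tail unfolding tail_def[abs_def] .
qed

end
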